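(* Let $T>0$ and let $X=\{X(t): t\in[0,T]\}$ be a centered Gaussian process which, for some $\gamma\in(0,1)$ and $\varkappa>0$, satisfies conditions (C1) and (C2) stated in the context (so that its Orey index is $\gamma$). With $Y_{k,n}$, $d^{Y,n}_{jk}$ and $\nu_n$ as defined in the context, assume that there is a sequence of real numbers $(\varepsilon_n)$, not depending on $\gamma$, such that $$\bigg|\frac{1}{n-1}\sum_{k=1}^{n-1}d^{Y,n}_{kk}-1\bigg|\le\varepsilon_n,\qquad\varepsilon_n\downarrow0,$$ and that there are constants $\upsilon_n>0$ such that $\nu_n\le\upsilon_n$. Let $\alpha\in(0,1)$. Then, for $n\ge2$ with $n>T$, $$\mathbf{P}\big(\gamma\in[\gamma_n^{inf}(\alpha),\gamma_n^{sup}(\alpha)]\big)\ge1-\alpha,$$ where $$\gamma_n^{inf}(\alpha)=\max\bigg(0,\ g_{n,T}^{-1}\bigg[\max\bigg(\ln^*\bigg(\bigg(\frac{x_{l,n}(\alpha/2)-\varepsilon_n}{S_n}\,\varkappa^2\bigg)\vee0\bigg),\,-\ln3\bigg)\bigg]\bigg),$$ $$\gamma_n^{sup}(\alpha)=\min\bigg(1,\ g_{n,T}^{-1}\bigg[\ln\bigg(\frac{x_{r,n}(\alpha/2)+\varepsilon_n}{S_n}\,\varkappa^2\bigg)\bigg]\bigg),$$ and $S_n$, $g_{n,T}$, $\ln^*$, $x_{l,n}$, $x_{r,n}$ are defined in the context.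
   Context: For a second order process $X$ on $[0,T]$ put $\sigma_X(s,t)=\big(\mathbf{E}[X(t)-X(s)]^2\big)^{1/2}$. Let $\widetilde\Psi$ be the class of continuous functions $\varphi:(0,T]\to[0,\infty)$ with $\lim_{h\downarrow0}\varphi(h)=0$ and $\varphi(h)/h\to\infty$ as $h\downarrow0$. Conditions, for $\gamma\in(0,1)$ and a constant $\varkappa>0$: (C1) $\sigma_X(0,\delta)\asymp\delta^{\gamma}$, i.e. $\sigma_X(0,\delta)$ and $\delta^\gamma$ are of the same order as $\delta\downarrow0$; (C2) for every $\varphi\in\widetilde\Psi$, $\displaystyle\sup_{\varphi(\delta)\le t\le T-\delta}\ \sup_{0<h\le\delta}\bigg|\frac{\sigma_X(t,t+h)}{\varkappa h^{\gamma}}-1\bigg|\to0$ as $\delta\downarrow0$. Orey index: assume $\sup_{0\le s\le T-h}\sigma_X(s,s+h)\to0$ as $h\to0$. For $\varphi\in\widetilde\Psi$ let $\gamma_*=\inf\{g>0:\lim_{h\downarrow0}\sup_{\varphi(h)\le s\le T-h}h^g/\sigma_X(s,s+h)=0\}$, $\widetilde\gamma_*=\inf\{g>0:\lim_{h\downarrow0}h^g/\sigma_X(0,h)=0\}$, $\gamma^*=\sup\{g>0:\lim_{h\downarrow0}\inf_{\varphi(h)\le s\le T-h}h^g/\sigma_X(s,s+h)=+\infty\}$, $\widetilde\gamma^*=\sup\{g>0:\lim_{h\downarrow0}h^g/\sigma_X(0,h)=+\infty\}$. If these four numbers coincide for every $\varphi\in\widetilde\Psi$, their common value is the Orey index of $X$.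 It is known that (C1) and (C2) with exponent $\gamma$ imply that the Orey index equals $\gamma$. Second differences: for $n\ge2$, $1\le k\le n-1$ and $t^n_k=kT/n$, $\Delta^{(2)}_{k,n}X=X(t^n_{k+1})-2X(t^n_k)+X(t^n_{k-1})$, $$Y_{k,n}=\frac{n^{\gamma}}{T^{\gamma}\varkappa\sqrt{4-2^{2\gamma}}}\,\Delta^{(2)}_{k,n}X,\quad d^{Y,n}_{jk}=\mathbf{E}[Y_{j,n}Y_{k,n}],\quad \nu_n=\max_{1\le k\le n-1}\sum_{j=1}^{n-1}|d^{Y,n}_{kj}|,\quad S_n=\frac1{n-1}\sum_{k=1}^{n-1}\big(\Delta^{(2)}_{k,n}X\big)^2.$$ Quantiles: for $\nu>0$ let $$\varphi_{r,n}(z;\nu,\varepsilon_n)=\exp\Big\{-\frac{z\sqrt{n-1}}{2\nu}\Big\}\Big(1+\frac{z}{(\varepsilon_n+1)\sqrt{n-1}}\Big)^{\frac{(\varepsilon_n+1)(n-1)}{2\nu}},$$ $$\varphi_{l,n}(z;\nu,\varepsilon_n)=\exp\Big\{\frac{z\sqrt{n-1}}{2\nu}\Big\}\Big(1-\frac{z}{(\varepsilon_n+1)\sqrt{n-1}}\Big)^{\frac{(\varepsilon_n+1)(n-1)}{2\nu}}\mathbf{1}_{[0,(\varepsilon_n+1)\sqrt{n-1}]}(z).$$ As functions of $z$, $\varphi_{r,n}$ is a bijection from $(0,\infty)$ onto $(0,1)$ and $\varphi_{l,n}$ is a bijection from $(0,(\varepsilon_n+1)\sqrt{n-1})$ onto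 $(0,1)$. For $a\in(0,1)$ let $q_{l,n}(a)$ and $q_{r,n}(a)$ be the values of $z$ with $\varphi_{l,n}(z;\upsilon_n,\varepsilon_n)=a$ and $\varphi_{r,n}(z;\upsilon_n,\varepsilon_n)=a$ respectively (on these intervals), and $$x_{l,n}(a)=1-\frac{q_{l,n}(a)}{\sqrt{n-1}},\qquad x_{r,n}(a)=1+\frac{q_{r,n}(a)}{\sqrt{n-1}}.$$ Further, $\ln^*x=\ln x$ for $x>0$, $\ln^*0=-\infty$, $a\vee b=\max(a,b)$, and $g_{n,T}(x)=2x\ln(n/T)-\ln(4-2^{2x})$ for $x\in(0,1)$, which for $n>T$ is a strictly increasing bijection from $(0,1)$ onto $(-\ln3,+\infty)$. Conventions: $g_{n,T}^{-1}(y)=0$ for $y\le-\ln3$, and $g_{n,T}^{-1}(+\infty)=1$; if $S_n=0$, then $c/S_n$ is read as $+\infty$ for $c>0$, $-\infty$ for $c<0$, and $0$ for $c=0$. *)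

theory Defs
  imports "HOL-Probability.Probability" "HOL-Library.Landau_Symbols"
begin

section \<open>Gaussian processes\<close>

text \<open>As usual for Gaussian processes, a constant counts as a (degenerate) Gaussian variable.\<close>

definition gaussian_rv :: "'a measure \<Rightarrow> ('a \<Rightarrow> real) \<Rightarrow> bool" where
  "gaussian_rv M Z \<longleftrightarrow> Z \<in> borel_measurable M \<and>
     (\<exists>\<mu>. (\<exists>\<sigma>>0. distributed M lborel Z (normal_density \<mu> \<sigma>)) \<or> (AE \<omega> in M. Z \<omega> = \<mu>))"

text \<open>A process on \<open>[0,T]\<close> is a function on all of \<^typ>\<open>real\<close> whose values outside \<open>[0,T]\<close> are
  irrelevant.\<close>

definition gaussian_process :: "'a measure \<Rightarrow> real \<Rightarrow> (real \<Rightarrow> 'a \<Rightarrow> real) \<Rightarrow> bool" where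
  "gaussian_process M T X \<longleftrightarrow>
     (\<forall>F c. finite F \<longrightarrow> F \<subseteq> {0..T} \<longrightarrow> gaussian_rv M (\<lambda>\<omega>. \<Sum>t\<in>F. c t * X t \<omega>))"

definition centered_process :: "'a measure \<Rightarrow> real \<Rightarrow> (real \<Rightarrow> 'a \<Rightarrow> real) \<Rightarrow> bool" where
  "centered_process M T X \<longleftrightarrow> (\<forall>t\<in>{0..T}. integral\<^sup>L M (X t) = 0)"

definition incr_sd :: "'a measure \<Rightarrow> (real \<Rightarrow> 'a \<Rightarrow> real) \<Rightarrow> real \<Rightarrow> real \<Rightarrow> real" where
  "incr_sd M X s t = sqrt (integral\<^sup>L M (\<lambda>\<omega>. (X t \<omega> - X s \<omega>)\<^sup>2))"

section \<open>The conditions on the increments\<close>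

definition Psi_class :: "real \<Rightarrow> (real \<Rightarrow> real) set" where
  "Psi_class T = {\<phi>. continuous_on {0<..T} \<phi> \<and> (\<forall>h\<in>{0<..T}. 0 \<le> \<phi> h) \<and>
     (\<phi> \<longlongrightarrow> 0) (at_right 0) \<and> filterlim (\<lambda>h. \<phi> h / h) at_top (at_right 0)}"

definition cond_C1 :: "'a measure \<Rightarrow> (real \<Rightarrow> 'a \<Rightarrow> real) \<Rightarrow> real \<Rightarrow> bool" where
  "cond_C1 M X \<gamma> \<longleftrightarrow> (\<lambda>\<delta>. incr_sd M X 0 \<delta>) \<in> \<Theta>[at_right 0](\<lambda>\<delta>. \<delta> powr \<gamma>)"

text \<open>The suprema are taken in \<^typ>\<open>ereal\<close>, where they exist without a boundedness
  assumption. The range of \<open>t\<close> is nonempty for all sufficiently small \<open>\<delta>\<close>.\<close>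

definition cond_C2 ::
    "'a measure \<Rightarrow> real \<Rightarrow> (real \<Rightarrow> 'a \<Rightarrow> real) \<Rightarrow> real \<Rightarrow> real \<Rightarrow> bool" where
  "cond_C2 M T X \<gamma> \<kappa> \<longleftrightarrow> (\<forall>\<phi>\<in>Psi_class T.
     ((\<lambda>\<delta>. SUP t\<in>{\<phi> \<delta>..T - \<delta>}. SUP h\<in>{0<..\<delta>}.
         ereal \<bar>incr_sd M X t (t + h) / (\<kappa> * h powr \<gamma>) - 1\<bar>) \<longlongrightarrow> 0) (at_right 0))"

section \<open>Second differences\<close>

definition grid :: "real \<Rightarrow> nat \<Rightarrow> nat \<Rightarrow> real" where
  "grid T n k = real k * T / real n"

definition second_diff ::
    "real \<Rightarrow> (real \<Rightarrow> 'a \<Rightarrow> real) \<Rightarrow> nat \<Rightarrow> nat \<Rightarrow> 'a \<Rightarrow> real" where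
  "second_diff T X n k \<omega> =
     X (grid T n (k + 1)) \<omega> - 2 * X (grid T n k) \<omega> + X (grid T n (k - 1)) \<omega>"

definition normalized_diff ::
    "real \<Rightarrow> (real \<Rightarrow> 'a \<Rightarrow> real) \<Rightarrow> real \<Rightarrow> real \<Rightarrow> nat \<Rightarrow> nat \<Rightarrow> 'a \<Rightarrow> real" where
  "normalized_diff T X \<gamma> \<kappa> n k \<omega> =
     real n powr \<gamma> / (T powr \<gamma> * \<kappa> * sqrt (4 - 2 powr (2 * \<gamma>))) * second_diff T X n k \<omega>"

definition diff_cov ::
    "'a measure \<Rightarrow> real \<Rightarrow> (real \<Rightarrow> 'a \<Rightarrow> real) \<Rightarrow> real \<Rightarrow> real \<Rightarrow> nat \<Rightarrow> nat \<Rightarrow> nat \<Rightarrow> real" where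
  "diff_cov M T X \<gamma> \<kappa> n j k =
     integral\<^sup>L M (\<lambda>\<omega>. normalized_diff T X \<gamma> \<kappa> n j \<omega> * normalized_diff T X \<gamma> \<kappa> n k \<omega>)"

definition max_row_sum ::
    "'a measure \<Rightarrow> real \<Rightarrow> (real \<Rightarrow> 'a \<Rightarrow> real) \<Rightarrow> real \<Rightarrow> real \<Rightarrow> nat \<Rightarrow> real" where
  "max_row_sum M T X \<gamma> \<kappa> n =
     (MAX k\<in>{1..n - 1}. \<Sum>j = 1..n - 1. \<bar>diff_cov M T X \<gamma> \<kappa> n k j\<bar>)"

definition mean_square_diff :: "real \<Rightarrow> (real \<Rightarrow> 'a \<Rightarrow> real) \<Rightarrow> nat \<Rightarrow> 'a \<Rightarrow> real" where
  "mean_square_diff T X n \<omega> = 1 / (real n - 1) * (\<Sum>k = 1..n - 1. (second_diff T X n k \<omega>)\<^sup>2)"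

section \<open>Quantiles\<close>

definition phi_r :: "nat \<Rightarrow> real \<Rightarrow> real \<Rightarrow> real \<Rightarrow> real" where
  "phi_r n \<nu> e z = exp (- (z * sqrt (real n - 1)) / (2 * \<nu>)) *
     (1 + z / ((e + 1) * sqrt (real n - 1))) powr ((e + 1) * (real n - 1) / (2 * \<nu>))"

definition phi_l :: "nat \<Rightarrow> real \<Rightarrow> real \<Rightarrow> real \<Rightarrow> real" where
  "phi_l n \<nu> e z = exp (z * sqrt (real n - 1) / (2 * \<nu>)) *
     (1 - z / ((e + 1) * sqrt (real n - 1))) powr ((e + 1) * (real n - 1) / (2 * \<nu>)) *
     indicator {0..(e + 1) * sqrt (real n - 1)} z"

definition q_r :: "nat \<Rightarrow> real \<Rightarrow> real \<Rightarrow> real \<Rightarrow> real" where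
  "q_r n \<nu> e a = the_inv_into {0<..} (phi_r n \<nu> e) a"

definition q_l :: "nat \<Rightarrow> real \<Rightarrow> real \<Rightarrow> real \<Rightarrow> real" where
  "q_l n \<nu> e a = the_inv_into {0<..<(e + 1) * sqrt (real n - 1)} (phi_l n \<nu> e) a"

definition x_r :: "nat \<Rightarrow> real \<Rightarrow> real \<Rightarrow> real \<Rightarrow> real" where
  "x_r n \<nu> e a = 1 + q_r n \<nu> e a / sqrt (real n - 1)"

definition x_l :: "nat \<Rightarrow> real \<Rightarrow> real \<Rightarrow> real \<Rightarrow> real" where
  "x_l n \<nu> e a = 1 - q_l n \<nu> e a / sqrt (real n - 1)"

section \<open>The confidence bounds\<close>

text \<open>The logarithm \<open>ln\<^sup>*\<close>, extended by \<open>ln\<^sup>* \<infinity> = \<infinity>\<close>; on positive arguments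
  it also serves as the ordinary logarithm. Negative arguments do not occur.\<close>

definition ln_star :: "ereal \<Rightarrow> ereal" where
  "ln_star x = (if x \<le> 0 then -\<infinity> else if x = \<infinity> then \<infinity> else ereal (ln (real_of_ereal x)))"

definition g_fun :: "nat \<Rightarrow> real \<Rightarrow> real \<Rightarrow> real" where
  "g_fun n T x = 2 * x * ln (real n / T) - ln (4 - 2 powr (2 * x))"

definition g_inv :: "nat \<Rightarrow> real \<Rightarrow> ereal \<Rightarrow> real" where
  "g_inv n T y = (if y \<le> ereal (- ln 3) then 0 else if y = \<infinity> then 1
     else the_inv_into {0<..<1} (g_fun n T) (real_of_ereal y))"

text \<open>Below \<open>e\<close>, \<open>u\<close> and \<open>s\<close> stand for \<open>\<epsilon>\<^sub>n\<close>, \<open>\<upsilon>\<^sub>n\<close> and the observed value of \<open>S\<^sub>n\<close>.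
  Division in \<^typ>\<open>ereal\<close> satisfies \<open>c / 0 = \<infinity>\<close> for \<open>c > 0\<close>, \<open>c / 0 = -\<infinity>\<close> for
  \<open>c < 0\<close> and \<open>0 / 0 = 0\<close>, which is the convention intended for \<open>s = 0\<close>.\<close>

definition gamma_inf ::
    "nat \<Rightarrow> real \<Rightarrow> real \<Rightarrow> real \<Rightarrow> real \<Rightarrow> real \<Rightarrow> real \<Rightarrow> real" where
  "gamma_inf n T \<kappa> e u \<alpha> s =
     max 0 (g_inv n T (max
       (ln_star (max (ereal (x_l n u e (\<alpha> / 2) - e) / ereal s * ereal (\<kappa>\<^sup>2)) 0))
       (ereal (- ln 3))))"

definition gamma_sup ::
    "nat \<Rightarrow> real \<Rightarrow> real \<Rightarrow> real \<Rightarrow> real \<Rightarrow> real \<Rightarrow> real \<Rightarrow> real" where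
  "gamma_sup n T \<kappa> e u \<alpha> s =
     min 1 (g_inv n T (ln_star (ereal (x_r n u e (\<alpha> / 2) + e) / ereal s * ereal (\<kappa>\<^sup>2))))"

end

theory Submission
  imports Defs "HOL-Real_Asymp.Real_Asymp"
begin

text \<open>Write $Y_k$ for the normalized second differences, $N = n - 1$ and
$V = \frac1N \sum_k Y_k^2$. The normalization is chosen so that $\kappa^2 V = e^{g(\gamma)} S_n$
with $g = g_{n,T}$, and $g$ increases on $(0,1)$. Taking logarithms and applying $g^{-1}$ therefore turns
$\gamma^{inf}_n \le \gamma \le \gamma^{sup}_n$ into $x_l - \varepsilon_n \le V \le x_r + \varepsilon_n$
(lemmas \<open>gamma_inf_le_iff\<close>, \<open>le_gamma_sup_iff\<close>). Since the mean of $V$ is within $\varepsilon_n$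
of $1$, it is enough that $V$ exceeds its mean by $q_r/\sqrt N$ with probability at most $\alpha/2$, and
falls below it by $q_l/\sqrt N$ with probability at most $\alpha/2$.

These tail bounds are Chernoff bounds. Let $D$ be the covariance matrix of the $Y_k$, with trace $\tau$ and
eigenvalues $\lambda_i$. The row sum bound $\upsilon_n$ gives $0 \le \lambda_i \le \nu := \upsilon_n$. Formally
$\sum_k Y_k^2 = \sum_i \lambda_i \xi_i^2$ with independent standard normal $\xi_i$, so that
\[ \mathbf{E} \exp\Big(t \sum_k Y_k^2\Big) = \prod_i (1 - 2 t \lambda_i)^{-1/2} \le (1 - 2 t \nu)^{-\tau/(2\nu)}, \]
where the inequality is Bernoulli's $(1 + x)^\theta \le 1 + \theta x$ with $\theta = \lambda_i/\nu$, used for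
either sign of $t$. Optimizing the resulting bounds over $t$ produces exactly $\varphi_{r,n}$ and
$\varphi_{l,n}$ (lemmas \<open>gaussian_quadratic_upper_tail\<close>, \<open>gaussian_quadratic_lower_tail\<close>).

All that is assumed of a Gaussian process is that linear combinations are Gaussian, which does not directly
exhibit independent $\xi_i$. The product formula is obtained from one-dimensional laws alone: with independent
standard normal auxiliary variables $\eta_i$ one has
$\exp(t \sum_i Z_i^2) = \mathbf{E}_\eta \exp(\sqrt{2t} \sum_i \eta_i Z_i)$, and by Fubini the expectation over
the $Z_i$ may be taken first, where it only involves the linear combination $\sum_i \eta_i Z_i$. For negative
exponents the same is done with characteristic functions.\<close>

section \<open>Eigenbases of symmetric matrices\<close>

text \<open>Vectors are functions, with inner product and matrix action taken over an index set \<open>I\<close> rather than a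
finite type, because the dimension $n - 1$ is a variable of the final statement.\<close>

definition dot :: "'i set \<Rightarrow> ('i \<Rightarrow> real) \<Rightarrow> ('i \<Rightarrow> real) \<Rightarrow> real" where
  "dot I x y = (\<Sum>a\<in>I. x a * y a)"

definition mat_app :: "'i set \<Rightarrow> ('i \<Rightarrow> 'i \<Rightarrow> real) \<Rightarrow> ('i \<Rightarrow> real) \<Rightarrow> 'i \<Rightarrow> real" where
  "mat_app I D x a = (\<Sum>b\<in>I. D a b * x b)"

definition orthonormal_family :: "'i set \<Rightarrow> 'i set \<Rightarrow> ('i \<Rightarrow> 'i \<Rightarrow> real) \<Rightarrow> bool" where
  "orthonormal_family I J v \<longleftrightarrow> (\<forall>i\<in>J. \<forall>j\<in>J. dot I (v i) (v j) = of_bool (i = j))"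

lemma dot_commute: "dot I x y = dot I y x"
  by (simp add: dot_def mult.commute)

lemma dot_linear:
  "dot I (\<lambda>a. x a + y a) z = dot I x z + dot I y z"
  "dot I (\<lambda>a. x a - y a) z = dot I x z - dot I y z"
  "dot I (\<lambda>a. c * x a) z = c * dot I x z"
  "dot I (\<lambda>a. \<Sum>j\<in>J. w j a) z = (\<Sum>j\<in>J. dot I (w j) z)"
  "dot I z (\<lambda>a. x a + y a) = dot I z x + dot I z y"
  "dot I z (\<lambda>a. x a - y a) = dot I z x - dot I z y"
  "dot I z (\<lambda>a. c * x a) = c * dot I z x"
  "dot I z (\<lambda>a. \<Sum>j\<in>J. w j a) = (\<Sum>j\<in>J. dot I z (w j))"
proof -
  show "dot I (\<lambda>a. \<Sum>j\<in>J. w j a) z = (\<Sum>j\<in>J. dot I (w j) z)"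
    by (simp add: dot_def sum_distrib_right) (rule sum.swap)
  show "dot I z (\<lambda>a. \<Sum>j\<in>J. w j a) = (\<Sum>j\<in>J. dot I z (w j))"
    by (simp add: dot_def sum_distrib_left) (rule sum.swap)
qed (simp_all add: dot_def algebra_simps sum.distrib sum_subtractf sum_distrib_left)

lemma mat_app_linear:
  "mat_app I D (\<lambda>a. x a + y a) = (\<lambda>a. mat_app I D x a + mat_app I D y a)"
  "mat_app I D (\<lambda>a. c * x a) = (\<lambda>a. c * mat_app I D x a)"
  by (auto simp: mat_app_def algebra_simps sum.distrib sum_distrib_left)

lemma dot_self_nonneg: "0 \<le> dot I x x"
  by (simp add: dot_def sum_nonneg)

lemma dot_self_eq_0_iff: "finite I \<Longrightarrow> dot I x x = 0 \<longleftrightarrow> (\<forall>a\<in>I. x a = 0)"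
  by (simp add: dot_def sum_nonneg_eq_0_iff)

lemma mat_app_symmetric:
  assumes "\<And>a b. a \<in> I \<Longrightarrow> b \<in> I \<Longrightarrow> D a b = D b a"
  shows "dot I x (mat_app I D y) = dot I y (mat_app I D x)"
proof -
  have "dot I x (mat_app I D y) = (\<Sum>a\<in>I. \<Sum>b\<in>I. D a b * x a * y b)"
    by (simp add: dot_def mat_app_def sum_distrib_left mult_ac)
  also have "\<dots> = (\<Sum>b\<in>I. \<Sum>a\<in>I. D a b * x a * y b)"
    by (rule sum.swap)
  also have "\<dots> = (\<Sum>b\<in>I. \<Sum>a\<in>I. D b a * x a * y b)"
    by (intro sum.cong refl) (simp add: assms)
  also have "\<dots> = dot I y (mat_app I D x)"
    by (simp add: dot_def mat_app_def sum_distrib_left mult_ac)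
  finally show ?thesis .
qed

text \<open>The component of the \<open>c\<close>-th unit vector orthogonal to the family \<open>v\<close> indexed by \<open>J\<close>, if that
family is orthonormal.\<close>

definition residual :: "'i set \<Rightarrow> ('i \<Rightarrow> 'i \<Rightarrow> real) \<Rightarrow> 'i \<Rightarrow> 'i \<Rightarrow> real" where
  "residual J v c a = of_bool (a = c) - (\<Sum>i\<in>J. v i c * v i a)"

lemma residual_eq: "residual J v c = (\<lambda>a. of_bool (a = c) - (\<Sum>i\<in>J. v i c * v i a))"
  by (rule ext) (simp add: residual_def)

lemma dot_unit: "finite I \<Longrightarrow> c \<in> I \<Longrightarrow> dot I (\<lambda>a. of_bool (a = c)) x = x c"
  by (simp add: dot_def of_bool_def if_distrib[of "\<lambda>t. t * _"] cong: if_cong)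

lemma
  assumes "finite I" "finite J" "orthonormal_family I J v" "c \<in> I"
  shows dot_residual_0: "j \<in> J \<Longrightarrow> dot I (residual J v c) (v j) = 0"
    and dot_residual_self: "dot I (residual J v c) (residual J v c) = 1 - (\<Sum>i\<in>J. (v i c)\<^sup>2)"
proof -
  have *: "dot I (residual J v c) (v j) = 0" if "j \<in> J" for j
  proof -
    have "dot I (residual J v c) (v j) = v j c - (\<Sum>i\<in>J. v i c * dot I (v i) (v j))"
      using assms by (simp add: residual_eq dot_linear dot_unit)
    also have "(\<Sum>i\<in>J. v i c * dot I (v i) (v j)) = (\<Sum>i\<in>J. if i = j then v i c else 0)"
      using assms that by (intro sum.cong refl) (auto simp: orthonormal_family_def)
    also have "\<dots> = v j c"
      using assms that by simp
    finally show ?thesis by simp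
  qed
  show "dot I (residual J v c) (v j) = 0" if "j \<in> J" using * that .
  have "dot I (residual J v c) (residual J v c) =
     dot I (\<lambda>a. of_bool (a = c)) (residual J v c) - (\<Sum>i\<in>J. v i c * dot I (v i) (residual J v c))"
    by (subst (1) residual_eq) (simp add: dot_linear)
  also have "\<dots> = residual J v c c"
    using assms * by (simp add: dot_unit dot_commute[of I "v _"])
  finally show "dot I (residual J v c) (residual J v c) = 1 - (\<Sum>i\<in>J. (v i c)\<^sup>2)"
    by (simp add: residual_def power2_eq_square)
qed

text \<open>A dimension count by traces: each member of the family removes exactly $1$ from the total squared length
$|I|$ of the unit vectors. Hence a family with fewer than $|I|$ members leaves a nonzero residual, and one with
$|I|$ members leaves none.\<close>

lemma sum_dot_residual:
  assumes "finite I" "finite J" "orthonormal_family I J v"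
  shows "(\<Sum>c\<in>I. dot I (residual J v c) (residual J v c)) = real (card I) - real (card J)"
proof -
  have "(\<Sum>c\<in>I. dot I (residual J v c) (residual J v c)) = (\<Sum>c\<in>I. 1 - (\<Sum>i\<in>J. (v i c)\<^sup>2))"
    using assms by (intro sum.cong refl dot_residual_self)
  also have "\<dots> = real (card I) - (\<Sum>c\<in>I. \<Sum>i\<in>J. (v i c)\<^sup>2)"
    by (simp add: sum_subtractf)
  also have "(\<Sum>c\<in>I. \<Sum>i\<in>J. (v i c)\<^sup>2) = (\<Sum>i\<in>J. dot I (v i) (v i))"
    by (subst sum.swap) (simp add: dot_def power2_eq_square)
  also have "\<dots> = real (card J)"
    using assms by (simp add: orthonormal_family_def)
  finally show ?thesis .
qed

lemma orthonormal_basis_complete: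
  assumes "finite I" "orthonormal_family I I v" "a \<in> I" "c \<in> I"
  shows "(\<Sum>i\<in>I. v i c * v i a) = of_bool (a = c)"
proof -
  have "dot I (residual I v c) (residual I v c) = 0"
    using sum_dot_residual[OF assms(1,1,2)] assms(1,4)
    by (simp add: sum_nonneg_eq_0_iff dot_self_nonneg)
  then have "residual I v c a = 0"
    using assms by (simp add: dot_self_eq_0_iff)
  then show ?thesis by (simp add: residual_def)
qed

lemma unit_vector_orthogonal_to_family:
  assumes "finite I" "J \<subseteq> I" "J \<noteq> I" "orthonormal_family I J v"
  obtains x where "dot I x x = 1" "\<And>j. j \<in> J \<Longrightarrow> dot I x (v j) = 0" "\<And>a. a \<notin> I \<Longrightarrow> x a = 0"
proof -
  have fJ: "finite J" using assms finite_subset by blast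
  have "card J < card I" using assms by (simp add: psubset_card_mono psubset_eq)
  then have "\<exists>c\<in>I. 0 < dot I (residual J v c) (residual J v c)"
    using sum_dot_residual[OF assms(1) fJ assms(4)]
    by (smt (verit) sum_nonpos of_nat_less_iff)
  then obtain c where c: "c \<in> I" and pos: "0 < dot I (residual J v c) (residual J v c)" by blast
  define n where "n = sqrt (dot I (residual J v c) (residual J v c))"
  have n: "n > 0" "n * n = dot I (residual J v c) (residual J v c)"
    using pos by (simp_all add: n_def)
  define x where "x = (\<lambda>a. if a \<in> I then residual J v c a / n else 0)"
  have dx: "dot I x y = dot I (residual J v c) y / n" for y
    by (simp add: dot_def x_def sum_divide_distrib)
  show thesis
  proof
    show "dot I x x = 1"
      by (subst dx, subst dot_commute, subst dx) (use n pos in simp)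
    show "dot I x (v j) = 0" if "j \<in> J" for j
      using that dot_residual_0[OF assms(1) fJ assms(4) c] by (simp add: dx)
    show "x a = 0" if "a \<notin> I" for a using that by (simp add: x_def)
  qed
qed

lemma compact_unit_vectors:
  assumes "finite I"
  shows "compact {x :: 'i \<Rightarrow> real. dot I x x = 1 \<and> (\<forall>j\<in>J. dot I x (v j) = 0) \<and> (\<forall>a. a \<notin> I \<longrightarrow> x a = 0)}"
    (is "compact ?K")
proof -
  define B where "B = PiE UNIV (\<lambda>a. if a \<in> I then {-1..1::real} else {0})"
  have "compactin (product_topology (\<lambda>_. euclidean) UNIV) B"
    unfolding B_def by (subst compactin_PiE) (auto)
  then have B: "compact B"
    by (simp add: euclidean_product_topology)
  have "?K \<subseteq> B"
  proof
    fix x assume x: "x \<in> ?K"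
    have "\<bar>x a\<bar> \<le> 1" if "a \<in> I" for a
    proof -
      have "x a * x a \<le> dot I x x" unfolding dot_def
        using that assms by (intro member_le_sum) auto
      then have "(x a)\<^sup>2 \<le> 1\<^sup>2" using x by (simp add: power2_eq_square)
      then show ?thesis by (simp only: abs_le_square_iff[symmetric] abs_one)
    qed
    then show "x \<in> B" using x by (auto simp: B_def abs_le_iff) 
  qed
  have cl: "closed ?K"
    unfolding dot_def Ball_def
    by (intro closed_Collect_conj closed_Collect_all closed_Collect_imp closed_Collect_eq)
       (auto intro!: continuous_intros continuous_on_product_coordinates)
  have "B \<inter> ?K = ?K" using \<open>?K \<subseteq> B\<close> by (rule Int_absorb1)
  with compact_Int_closed[OF B cl] show ?thesis by simp
qed

lemma nonneg_quadratic_no_linear_term: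
  fixes b c :: real
  assumes "\<And>s. 0 \<le> 2 * s * b + s\<^sup>2 * c"
  shows "b = 0"
proof (rule ccontr)
  assume b: "b \<noteq> 0"
  show False
  proof (cases "c \<le> 0")
    case True
    have "0 \<le> 2 * (-b) * b + (-b)\<^sup>2 * c" by (rule assms)
    moreover have "b\<^sup>2 * c \<le> 0" using True by (simp add: mult_nonneg_nonpos)
    moreover have "b * b > 0" using b by (auto simp: zero_less_mult_iff)
    ultimately show False by simp
  next
    case False
    have "0 \<le> 2 * (-b/c) * b + (-b/c)\<^sup>2 * c" by (rule assms)
    also have "\<dots> = - (b * b / c)" using False by (simp add: field_simps power2_eq_square)
    finally have "b * b / c \<le> 0" by simp
    moreover have "b * b / c > 0" using b False by (intro divide_pos_pos) (auto simp: zero_less_mult_iff)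
    ultimately show False by simp
  qed
qed

text \<open>The eigenvector is a maximizer \<open>x\<close> of the quadratic form on the unit sphere of the orthogonal complement.
With \<open>m\<close> the maximum, $w \mapsto m |w|^2 - w \cdot D w$ is nonnegative on the complement and vanishes at \<open>x\<close>,
so its derivative at \<open>x\<close> in any direction \<open>u\<close> of the complement vanishes. The vector $u = m x - D x$ lies in
the complement because \<open>D\<close> is symmetric and preserves the span of the eigenvectors already found; this
direction gives $|u|^2 = 0$.\<close>

lemma eigenvector_orthogonal_to_eigenvectors:
  assumes I: "finite I" "J \<subseteq> I" "J \<noteq> I" and v: "orthonormal_family I J v"
    and sym: "\<And>a b. a \<in> I \<Longrightarrow> b \<in> I \<Longrightarrow> D a b = D b a"
    and eig: "\<And>j a. j \<in> J \<Longrightarrow> a \<in> I \<Longrightarrow> mat_app I D (v j) a = l j * v j a"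
  obtains x m where "dot I x x = 1" "\<And>j. j \<in> J \<Longrightarrow> dot I x (v j) = 0"
    "\<And>a. a \<in> I \<Longrightarrow> mat_app I D x a = m * x a"
proof -
  let ?K = "{x. dot I x x = 1 \<and> (\<forall>j\<in>J. dot I x (v j) = 0) \<and> (\<forall>a. a \<notin> I \<longrightarrow> x a = 0)}"
  let ?q = "\<lambda>x. dot I x (mat_app I D x)"
  have "?K \<noteq> {}"
  proof -
    obtain x where "dot I x x = 1" "\<And>j. j \<in> J \<Longrightarrow> dot I x (v j) = 0" "\<And>a. a \<notin> I \<Longrightarrow> x a = 0"
      by (rule unit_vector_orthogonal_to_family[OF I v]) blast
    then show ?thesis by blast
  qed
  moreover have "continuous_on ?K ?q"
    unfolding dot_def mat_app_def
    by (intro continuous_intros continuous_on_subset[OF continuous_on_product_coordinates]) auto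
  ultimately obtain x where x: "x \<in> ?K" and max: "\<And>y. y \<in> ?K \<Longrightarrow> ?q y \<le> ?q x"
    using continuous_attains_sup[OF compact_unit_vectors[OF I(1), of J v], of ?q] by blast
  define m where "m = ?q x"
  have x1: "dot I x x = 1" and xv: "\<And>j. j \<in> J \<Longrightarrow> dot I x (v j) = 0" using x by auto
  \<comment> \<open>By homogeneity, m bounds the Rayleigh quotient on the orthogonal complement.\<close>
  have nonneg: "0 \<le> m * dot I w w - ?q w" if w: "\<And>j. j \<in> J \<Longrightarrow> dot I w (v j) = 0" for w
  proof (cases "dot I w w = 0")
    case True
    then have "\<forall>a\<in>I. w a = 0" using I by (simp add: dot_self_eq_0_iff)
    then have "?q w = 0" by (simp add: dot_def)
    with True show ?thesis by simp
  next
    case False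
    define n where "n = sqrt (dot I w w)"
    have n: "n > 0" "dot I w w = n * n"
      using False dot_self_nonneg[of I w] by (simp_all add: n_def)
    define y where "y = (\<lambda>a. if a \<in> I then w a / n else 0)"
    have dy: "dot I y z = dot I w z / n" for z
      by (simp add: dot_def y_def sum_divide_distrib)
    have "mat_app I D y = (\<lambda>a. (1 / n) * mat_app I D w a)"
      by (simp add: fun_eq_iff mat_app_def y_def sum_divide_distrib)
    then have "?q y = dot I w (\<lambda>a. (1 / n) * mat_app I D w a) / n"
      by (simp only: dy)
    then have qy: "?q y = ?q w / (n * n)" by (simp only: dot_linear) simp
    have "dot I y y = 1"
      by (subst dy, subst dot_commute, subst dy) (use n in simp)
    moreover have "\<forall>j\<in>J. dot I y (v j) = 0" using w by (simp add: dy)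
    moreover have "\<forall>a. a \<notin> I \<longrightarrow> y a = 0" by (simp add: y_def)
    ultimately have "y \<in> ?K" by blast
    then have "?q y \<le> ?q x" by (rule max)
    then have "?q w / (n * n) \<le> m" by (simp add: qy m_def)
    then show ?thesis using n by (simp add: field_simps)
  qed
  define u where "u = (\<lambda>a. m * x a - mat_app I D x a)"
  have uv: "dot I u (v j) = 0" if j: "j \<in> J" for j
  proof -
    have "dot I (mat_app I D x) (v j) = dot I x (mat_app I D (v j))"
      using mat_app_symmetric[of I D "v j" x] sym by (subst dot_commute) simp
    also have "\<dots> = l j * dot I x (v j)"
      using eig[OF j] by (simp add: dot_def sum_distrib_left mult_ac)
    finally show ?thesis using xv[OF j] by (simp add: u_def dot_linear)
  qed
  have "dot I u u = 0"
  proof (rule nonneg_quadratic_no_linear_term)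
    fix s
    let ?w = "\<lambda>a. x a + s * u a"
    have "dot I u (\<lambda>a. m * x a - mat_app I D x a) = dot I u u" by (simp add: u_def)
    then have e: "dot I u (mat_app I D x) = m * dot I u x - dot I u u" by (simp add: dot_linear)
    have "0 \<le> m * dot I ?w ?w - ?q ?w"
      by (rule nonneg) (simp add: dot_linear uv xv)
    also have "\<dots> = 2 * s * dot I u u + s\<^sup>2 * (m * dot I u u - ?q u)"
      using mat_app_symmetric[of I D x u] sym
      by (simp add: dot_linear mat_app_linear m_def[symmetric] x1 e dot_commute[of I x u])
         (simp add: algebra_simps power2_eq_square)
    finally show "0 \<le> 2 * s * dot I u u + s\<^sup>2 * (m * dot I u u - ?q u)" .
  qed
  then have "mat_app I D x a = m * x a" if "a \<in> I" for a
    using I that by (simp add: dot_self_eq_0_iff u_def)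
  then show thesis using that[OF x1] xv by blast
qed

lemma symmetric_matrix_eigenbasis:
  assumes I: "finite I" and sym: "\<And>a b. a \<in> I \<Longrightarrow> b \<in> I \<Longrightarrow> D a b = D b a"
  obtains v l where "orthonormal_family I I v"
    "\<And>j a. j \<in> I \<Longrightarrow> a \<in> I \<Longrightarrow> mat_app I D (v j) a = l j * v j a"
proof -
  have "\<exists>v l. orthonormal_family I J v \<and> (\<forall>j\<in>J. \<forall>a\<in>I. mat_app I D (v j) a = l j * v j a)"
    if "finite J" "J \<subseteq> I" for J
    using that
  proof (induction J rule: finite_induct)
    case empty
    then show ?case by (simp add: orthonormal_family_def)
  next
    case (insert k J)
    then obtain v l where v: "orthonormal_family I J v"
      and eig: "\<And>j a. j \<in> J \<Longrightarrow> a \<in> I \<Longrightarrow> mat_app I D (v j) a = l j * v j a"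
      by (metis insert_subset)
    have J: "J \<subseteq> I" "J \<noteq> I" using insert by auto
    obtain x m where x: "dot I x x = 1" "\<And>j. j \<in> J \<Longrightarrow> dot I x (v j) = 0"
      "\<And>a. a \<in> I \<Longrightarrow> mat_app I D x a = m * x a"
      by (rule eigenvector_orthogonal_to_eigenvectors[OF I J v sym eig]) auto
    have x': "dot I (v j) x = 0" if "j \<in> J" for j
      using x(2)[OF that] by (simp add: dot_commute)
    have "orthonormal_family I (insert k J) (v(k := x))"
      using v x(1,2) x' insert.hyps by (auto simp: orthonormal_family_def)
    moreover have "\<forall>j\<in>insert k J. \<forall>a\<in>I.
        mat_app I D ((v(k := x)) j) a = (l(k := m)) j * (v(k := x)) j a"
      using eig x(3) insert.hyps by auto
    ultimately show ?case by blast
  qed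
  from this[OF I order_refl] show thesis using that by blast
qed

text \<open>Invariance of the trace under an orthonormal change of basis. The rank one matrix $y y^T$ gives Parseval's
identity (\<open>sum_squares_orthonormal_coordinates\<close>).\<close>

lemma sum_eigenbasis_trace:
  assumes "finite I" "orthonormal_family I I v"
  shows "(\<Sum>i\<in>I. dot I (v i) (mat_app I D (v i))) = (\<Sum>a\<in>I. D a a)"
proof -
  have "(\<Sum>i\<in>I. dot I (v i) (mat_app I D (v i))) = (\<Sum>i\<in>I. \<Sum>a\<in>I. \<Sum>b\<in>I. D a b * (v i a * v i b))"
    by (simp add: dot_def mat_app_def sum_distrib_left mult_ac)
  also have "\<dots> = (\<Sum>a\<in>I. \<Sum>b\<in>I. \<Sum>i\<in>I. D a b * (v i a * v i b))"
    by (subst sum.swap, rule sum.cong[OF refl], rule sum.swap)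
  also have "\<dots> = (\<Sum>a\<in>I. \<Sum>b\<in>I. if b = a then D a b else 0)"
    using orthonormal_basis_complete[OF assms]
    by (intro sum.cong refl) (auto simp: sum_distrib_left[symmetric])
  also have "\<dots> = (\<Sum>a\<in>I. D a a)" using assms by simp
  finally show ?thesis .
qed

lemma sum_squares_orthonormal_coordinates:
  assumes "finite I" "orthonormal_family I I v"
  shows "(\<Sum>i\<in>I. (dot I (v i) y)\<^sup>2) = (\<Sum>a\<in>I. (y a)\<^sup>2)"
proof -
  have "(dot I (v i) y)\<^sup>2 = dot I (v i) (mat_app I (\<lambda>a b. y a * y b) (v i))" for i
    by (simp add: dot_def mat_app_def power2_eq_square sum_product sum_distrib_left mult_ac)
  then show ?thesis
    using sum_eigenbasis_trace[OF assms, of "\<lambda>a b. y a * y b"] by (simp add: power2_eq_square)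
qed

text \<open>Schur's test: bound $x_a x_b$ by $(x_a^2 + x_b^2)/2$; by symmetry both halves contribute the same row sums.\<close>

lemma quadratic_form_le_row_sum:
  assumes fin: "finite I" and sym: "\<And>a b. a \<in> I \<Longrightarrow> b \<in> I \<Longrightarrow> D a b = D b a"
    and row: "\<And>a. a \<in> I \<Longrightarrow> (\<Sum>b\<in>I. \<bar>D a b\<bar>) \<le> \<nu>"
  shows "dot I x (mat_app I D x) \<le> \<nu> * dot I x x"
proof -
  have "dot I x (mat_app I D x) = (\<Sum>a\<in>I. \<Sum>b\<in>I. D a b * (x a * x b))"
    by (simp add: dot_def mat_app_def sum_distrib_left mult_ac)
  also have "\<dots> \<le> (\<Sum>a\<in>I. \<Sum>b\<in>I. \<bar>D a b\<bar> * (x a)\<^sup>2 / 2 + \<bar>D a b\<bar> * (x b)\<^sup>2 / 2)"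
  proof (intro sum_mono)
    fix a b
    have "\<bar>x a * x b\<bar> \<le> ((x a)\<^sup>2 + (x b)\<^sup>2) / 2"
      using sum_squares_bound[of "\<bar>x a\<bar>" "\<bar>x b\<bar>"] by (simp add: abs_mult)
    then have "\<bar>D a b\<bar> * \<bar>x a * x b\<bar> \<le> \<bar>D a b\<bar> * (((x a)\<^sup>2 + (x b)\<^sup>2) / 2)"
      by (rule mult_left_mono) simp
    moreover have "D a b * (x a * x b) \<le> \<bar>D a b\<bar> * \<bar>x a * x b\<bar>"
      by (metis abs_ge_self abs_mult)
    ultimately show "D a b * (x a * x b) \<le> \<bar>D a b\<bar> * (x a)\<^sup>2 / 2 + \<bar>D a b\<bar> * (x b)\<^sup>2 / 2"
      by (simp add: algebra_simps)
  qed
  also have "\<dots> = (\<Sum>a\<in>I. \<Sum>b\<in>I. \<bar>D a b\<bar> * (x a)\<^sup>2 / 2) + (\<Sum>a\<in>I. \<Sum>b\<in>I. \<bar>D a b\<bar> * (x b)\<^sup>2 / 2)"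
    by (simp add: sum.distrib)
  also have "(\<Sum>a\<in>I. \<Sum>b\<in>I. \<bar>D a b\<bar> * (x b)\<^sup>2 / 2) = (\<Sum>a\<in>I. \<Sum>b\<in>I. \<bar>D a b\<bar> * (x a)\<^sup>2 / 2)"
    by (subst sum.swap, intro sum.cong refl) (simp add: sym)
  also have "(\<Sum>a\<in>I. \<Sum>b\<in>I. \<bar>D a b\<bar> * (x a)\<^sup>2 / 2) + (\<Sum>a\<in>I. \<Sum>b\<in>I. \<bar>D a b\<bar> * (x a)\<^sup>2 / 2)
      = (\<Sum>a\<in>I. (\<Sum>b\<in>I. \<bar>D a b\<bar>) * (x a)\<^sup>2)"
    by (simp add: sum.distrib[symmetric] sum_distrib_right)
  also have "\<dots> \<le> (\<Sum>a\<in>I. \<nu> * (x a)\<^sup>2)"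
    using row by (intro sum_mono mult_right_mono) auto
  also have "\<dots> = \<nu> * dot I x x" by (simp add: dot_def sum_distrib_left power2_eq_square)
  finally show ?thesis .
qed

section \<open>Integrals against standard normal variables\<close>

lemma nn_integral_exp_std_normal:
  "(\<integral>\<^sup>+x. ennreal (exp (s * x)) \<partial>std_normal_distribution) = ennreal (exp (s\<^sup>2 / 2))"
proof -
  have eq: "std_normal_density x * exp (s * x) = exp (s\<^sup>2 / 2) * normal_density s 1 x" for x
    by (simp add: normal_density_def mult_exp_exp power2_eq_square field_simps)
  have "(\<integral>\<^sup>+x. ennreal (exp (s * x)) \<partial>std_normal_distribution) =
      (\<integral>\<^sup>+x. ennreal (exp (s\<^sup>2 / 2)) * ennreal (normal_density s 1 x) \<partial>lborel)"
    by (simp add: nn_integral_density ennreal_mult'[symmetric] normal_density_nonneg eq)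
  also have "\<dots> = ennreal (exp (s\<^sup>2 / 2)) * (\<integral>\<^sup>+x. ennreal (normal_density s 1 x) \<partial>lborel)"
    by (intro nn_integral_cmult) simp
  also have "(\<integral>\<^sup>+x. ennreal (normal_density s 1 x) \<partial>lborel) = 1"
    by (subst nn_integral_eq_integral) (auto simp: normal_density_nonneg)
  finally show ?thesis by simp
qed

lemma nn_integral_exp_square_std_normal:
  assumes "2 * c < 1"
  shows "(\<integral>\<^sup>+x. ennreal (exp (c * x\<^sup>2)) \<partial>std_normal_distribution) = ennreal (1 / sqrt (1 - 2 * c))"
proof -
  define \<sigma> where "\<sigma> = 1 / sqrt (1 - 2 * c)"
  have \<sigma>: "\<sigma> > 0" "\<sigma>\<^sup>2 = 1 / (1 - 2 * c)" using assms by (simp_all add: \<sigma>_def power_divide)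
  have eq: "std_normal_density x * exp (c * x\<^sup>2) = \<sigma> * normal_density 0 \<sigma> x" for x
  proof -
    have "- (x\<^sup>2 / (2 * \<sigma>\<^sup>2)) = c * x\<^sup>2 - x\<^sup>2 / 2"
      using assms by (simp add: \<sigma> field_simps)
    then show ?thesis using \<sigma>(1)
      by (simp add: normal_density_def mult_exp_exp real_sqrt_mult)
  qed
  have "(\<integral>\<^sup>+x. ennreal (exp (c * x\<^sup>2)) \<partial>std_normal_distribution) =
      (\<integral>\<^sup>+x. ennreal \<sigma> * ennreal (normal_density 0 \<sigma> x) \<partial>lborel)"
    using \<sigma>(1)
    by (simp add: nn_integral_density ennreal_mult'[symmetric] normal_density_nonneg eq)
  also have "\<dots> = ennreal \<sigma> * (\<integral>\<^sup>+x. ennreal (normal_density 0 \<sigma> x) \<partial>lborel)"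
    by (intro nn_integral_cmult) simp
  also have "(\<integral>\<^sup>+x. ennreal (normal_density 0 \<sigma> x) \<partial>lborel) = 1"
    using \<sigma>(1) by (subst nn_integral_eq_integral) (auto simp: normal_density_nonneg)
  finally show ?thesis by (simp add: \<sigma>_def)
qed

lemma integral_exp_neg_square_std_normal:
  assumes "0 \<le> c"
  shows "integrable std_normal_distribution (\<lambda>x. exp (- (c * x\<^sup>2)))"
    and "(\<integral>x. exp (- (c * x\<^sup>2)) \<partial>std_normal_distribution) = 1 / sqrt (1 + 2 * c)"
proof -
  have "has_bochner_integral std_normal_distribution (\<lambda>x. exp (- (c * x\<^sup>2))) (1 / sqrt (1 + 2 * c))"
    using nn_integral_exp_square_std_normal[of "-c"] assms
    by (intro has_bochner_integral_nn_integral) auto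
  then show "integrable std_normal_distribution (\<lambda>x. exp (- (c * x\<^sup>2)))"
    and "(\<integral>x. exp (- (c * x\<^sup>2)) \<partial>std_normal_distribution) = 1 / sqrt (1 + 2 * c)"
    by (auto simp: has_bochner_integral_iff)
qed

lemma
  shows integrable_square_std_normal: "integrable std_normal_distribution (\<lambda>x. x\<^sup>2)"
    and integral_square_std_normal: "(\<integral>x. x\<^sup>2 \<partial>std_normal_distribution) = 1"
  using std_normal_moment_even[of 1] 
  by (auto simp: has_bochner_integral_iff integral_density integrable_density normal_density_nonneg)

text \<open>The auxiliary variables \<open>h\<close> linearize the squares:
$e^{t z^2} = \mathbf{E}\, e^{r \eta z}$ for $r = \sqrt{2t}$ and standard normal $\eta$. After exchanging the
integrals, the hypothesis on linear combinations leaves $\mathbf{E} \prod_i e^{t l_i \eta_i^2}$. Nonnegative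
integrals are used because integrability of the left-hand side is part of what is being shown.\<close>

lemma nn_integral_exp_sum_squares:
  assumes M: "sigma_finite_measure M" and fin: "finite I"
    and meas: "\<And>i. i \<in> I \<Longrightarrow> Z i \<in> borel_measurable M"
    and mgf: "\<And>u. (\<integral>\<^sup>+\<omega>. ennreal (exp (\<Sum>i\<in>I. u i * Z i \<omega>)) \<partial>M) = ennreal (exp (\<Sum>i\<in>I. l i * (u i)\<^sup>2 / 2))"
    and t: "0 \<le> t" "\<And>i. i \<in> I \<Longrightarrow> 2 * t * l i < 1"
  shows "(\<integral>\<^sup>+\<omega>. ennreal (exp (t * (\<Sum>i\<in>I. (Z i \<omega>)\<^sup>2))) \<partial>M) =
      ennreal (\<Prod>i\<in>I. 1 / sqrt (1 - 2 * t * l i))"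
proof -
  let ?G = "std_normal_distribution"
  interpret G: prob_space ?G by (rule prob_space_normal_density) simp
  interpret P: product_sigma_finite "\<lambda>_. ?G" ..
  interpret M: sigma_finite_measure M by fact
  let ?P = "PiM I (\<lambda>_. ?G)"
  interpret PP: finite_product_sigma_finite "\<lambda>_. ?G" I by standard fact
  interpret MP: pair_sigma_finite M ?P ..
  define r where "r = sqrt (2 * t)"
  have r: "r\<^sup>2 = 2 * t" using t by (simp add: r_def)
  have comp[measurable]: "(\<lambda>h. h i) \<in> borel_measurable ?P" if "i \<in> I" for i
    using measurable_component_singleton[OF that, of "\<lambda>_. ?G"] by (simp cong: measurable_cong_sets)
  note meas[measurable]
  have pairmeas: "(\<lambda>(\<omega>, h). \<Sum>i\<in>I. r * h i * Z i \<omega>) \<in> borel_measurable (M \<Otimes>\<^sub>M ?P)"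
    unfolding split_beta by (intro borel_measurable_sum) measurable
  have "(\<integral>\<^sup>+\<omega>. ennreal (exp (t * (\<Sum>i\<in>I. (Z i \<omega>)\<^sup>2))) \<partial>M) =
     (\<integral>\<^sup>+\<omega>. \<integral>\<^sup>+h. ennreal (exp (\<Sum>i\<in>I. r * h i * Z i \<omega>)) \<partial>?P \<partial>M)"
  proof (intro nn_integral_cong)
    fix \<omega>
    have "(\<integral>\<^sup>+h. ennreal (exp (\<Sum>i\<in>I. r * h i * Z i \<omega>)) \<partial>?P) =
        (\<integral>\<^sup>+h. (\<Prod>i\<in>I. ennreal (exp ((r * Z i \<omega>) * h i))) \<partial>?P)"
      using fin by (simp add: exp_sum prod_ennreal mult_ac)
    also have "\<dots> = (\<Prod>i\<in>I. \<integral>\<^sup>+x. ennreal (exp ((r * Z i \<omega>) * x)) \<partial>?G)"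
      by (intro P.product_nn_integral_prod fin) simp
    also have "\<dots> = ennreal (exp (t * (\<Sum>i\<in>I. (Z i \<omega>)\<^sup>2)))"
      by (simp only: nn_integral_exp_std_normal)
         (simp add: prod_ennreal exp_sum[OF fin, symmetric] power_mult_distrib r sum_distrib_left)
    finally show "ennreal (exp (t * (\<Sum>i\<in>I. (Z i \<omega>)\<^sup>2))) = (\<integral>\<^sup>+h. ennreal (exp (\<Sum>i\<in>I. r * h i * Z i \<omega>)) \<partial>?P)" ..
  qed
  also have "\<dots> = (\<integral>\<^sup>+h. \<integral>\<^sup>+\<omega>. ennreal (exp (\<Sum>i\<in>I. r * h i * Z i \<omega>)) \<partial>M \<partial>?P)"
    using pairmeas by (intro MP.Fubini'[symmetric]) (simp add: split_beta)
  also have "\<dots> = (\<integral>\<^sup>+h. (\<Prod>i\<in>I. ennreal (exp ((t * l i) * (h i)\<^sup>2))) \<partial>?P)"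
    using fin by (simp only: mgf) (simp add: prod_ennreal exp_sum[symmetric] power_mult_distrib r mult_ac)
  also have "\<dots> = (\<Prod>i\<in>I. \<integral>\<^sup>+x. ennreal (exp ((t * l i) * x\<^sup>2)) \<partial>?G)"
    by (intro P.product_nn_integral_prod fin) simp
  also have "\<dots> = (\<Prod>i\<in>I. ennreal (1 / sqrt (1 - 2 * t * l i)))"
    using t(2) by (intro prod.cong refl, subst nn_integral_exp_square_std_normal) (simp_all add: mult.assoc)
  also have "\<dots> = ennreal (\<Prod>i\<in>I. 1 / sqrt (1 - 2 * t * l i))"
    using t by (intro prod_ennreal) (simp add: less_imp_le)
  finally show ?thesis .
qed

text \<open>The counterpart of \<open>nn_integral_exp_sum_squares\<close> for negative exponents, where the linearization becomes
$e^{- t z^2} = \mathbf{E}\, e^{i r \eta z}$ and all integrands are bounded.\<close>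

lemma integral_exp_neg_sum_squares:
  assumes M: "finite_measure M" and fin: "finite I"
    and meas: "\<And>i. i \<in> I \<Longrightarrow> Z i \<in> borel_measurable M"
    and char: "\<And>u. (\<integral>\<omega>. iexp (\<Sum>i\<in>I. u i * Z i \<omega>) \<partial>M) = complex_of_real (exp (- (\<Sum>i\<in>I. l i * (u i)\<^sup>2 / 2)))"
    and t: "0 \<le> t" "\<And>i. i \<in> I \<Longrightarrow> 0 \<le> l i"
  shows "(\<integral>\<omega>. exp (- (t * (\<Sum>i\<in>I. (Z i \<omega>)\<^sup>2))) \<partial>M) =
      (\<Prod>i\<in>I. 1 / sqrt (1 + 2 * t * l i))"
proof -
  let ?G = "std_normal_distribution"
  interpret G: prob_space ?G by (rule prob_space_normal_density) simp
  interpret P: product_sigma_finite "\<lambda>_. ?G" ..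
  interpret M: finite_measure M by fact
  let ?P = "PiM I (\<lambda>_. ?G)"
  interpret P': prob_space ?P by (intro prob_space_PiM G.prob_space_axioms)
  interpret MP: pair_sigma_finite M ?P ..
  define r where "r = sqrt (2 * t)"
  have r: "r\<^sup>2 = 2 * t" using t by (simp add: r_def)
  have comp[measurable]: "(\<lambda>h. h i) \<in> borel_measurable ?P" if "i \<in> I" for i
    using measurable_component_singleton[OF that, of "\<lambda>_. ?G"] by (simp cong: measurable_cong_sets)
  note meas[measurable]
  interpret MPf: finite_measure "M \<Otimes>\<^sub>M ?P"
    by (rule finite_measure_pair_measure) (rule M P'.finite_measure_axioms)+
  have pairmeas: "(\<lambda>p. \<Sum>i\<in>I. r * snd p i * Z i (fst p)) \<in> borel_measurable (M \<Otimes>\<^sub>M ?P)"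
    by (intro borel_measurable_sum) measurable
  have int: "integrable (M \<Otimes>\<^sub>M ?P) (\<lambda>(\<omega>, h). iexp (\<Sum>i\<in>I. r * h i * Z i \<omega>))"
    using pairmeas unfolding split_beta
    by (intro MPf.integrable_const_bound[where B = 1]) (auto simp del: of_real_sum)
  have std: "(\<integral>x. iexp (c * x) \<partial>?G) = complex_of_real (exp (- (c\<^sup>2) / 2))" for c
    using char_std_normal_distribution by (simp add: char_def fun_eq_iff)
  have inti: "integrable ?G (\<lambda>x. iexp (c * x))" for c
    by (intro G.integrable_const_bound[where B = 1]) auto
  have "complex_of_real (\<integral>\<omega>. exp (- (t * (\<Sum>i\<in>I. (Z i \<omega>)\<^sup>2))) \<partial>M) =
     (\<integral>\<omega>. complex_of_real (exp (- (t * (\<Sum>i\<in>I. (Z i \<omega>)\<^sup>2)))) \<partial>M)" by simp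
  also have "\<dots> = (\<integral>\<omega>. \<integral>h. iexp (\<Sum>i\<in>I. r * h i * Z i \<omega>) \<partial>?P \<partial>M)"
  proof (intro Bochner_Integration.integral_cong refl)
    fix \<omega>
    have "(\<integral>h. iexp (\<Sum>i\<in>I. r * h i * Z i \<omega>) \<partial>?P) =
        (\<integral>h. (\<Prod>i\<in>I. iexp ((r * Z i \<omega>) * h i)) \<partial>?P)"
      using fin by (simp add: exp_sum[symmetric] sum_distrib_left mult_ac)
    also have "\<dots> = (\<Prod>i\<in>I. \<integral>x. iexp ((r * Z i \<omega>) * x) \<partial>?G)"
      by (intro P.product_integral_prod fin inti)
    also have "\<dots> = (\<Prod>i\<in>I. complex_of_real (exp (- ((r * Z i \<omega>)\<^sup>2) / 2)))"
      by (simp only: std)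
    also have "\<dots> = complex_of_real (exp (- (t * (\<Sum>i\<in>I. (Z i \<omega>)\<^sup>2))))"
      by (simp only: of_real_prod[symmetric] exp_sum[OF fin, symmetric])
         (simp add: power_mult_distrib r sum_distrib_left sum_negf)
    finally show "complex_of_real (exp (- (t * (\<Sum>i\<in>I. (Z i \<omega>)\<^sup>2)))) = (\<integral>h. iexp (\<Sum>i\<in>I. r * h i * Z i \<omega>) \<partial>?P)" ..
  qed
  also have "\<dots> = (\<integral>h. \<integral>\<omega>. iexp (\<Sum>i\<in>I. r * h i * Z i \<omega>) \<partial>M \<partial>?P)"
    by (rule MP.Fubini_integral[OF int, symmetric])
  also have "\<dots> = (\<integral>h. complex_of_real (\<Prod>i\<in>I. exp (- ((t * l i) * (h i)\<^sup>2))) \<partial>?P)"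
    by (simp only: char exp_sum[OF fin, symmetric])
       (simp add: power_mult_distrib r mult_ac sum_negf)
  also have "\<dots> = complex_of_real (\<integral>h. (\<Prod>i\<in>I. exp (- ((t * l i) * (h i)\<^sup>2))) \<partial>?P)"
    by (rule integral_complex_of_real)
  also have "(\<integral>h. (\<Prod>i\<in>I. exp (- ((t * l i) * (h i)\<^sup>2))) \<partial>?P) = (\<Prod>i\<in>I. \<integral>x. exp (- ((t * l i) * x\<^sup>2)) \<partial>?G)"
    using t by (intro P.product_integral_prod fin integral_exp_neg_square_std_normal) simp
  also have "\<dots> = (\<Prod>i\<in>I. 1 / sqrt (1 + 2 * t * l i))"
    using t by (intro prod.cong refl, subst integral_exp_neg_square_std_normal) (simp_all add: mult_ac)
  finally show ?thesis by (simp only: of_real_eq_iff)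
qed

section \<open>Linear combinations of Gaussian variables\<close>

text \<open>Writing the law as that of $\sigma$ times a standard normal variable covers the degenerate case by
$\sigma = 0$.\<close>

lemma centered_gaussian_distr:
  assumes "prob_space M" "gaussian_rv M Z" "integral\<^sup>L M Z = 0"
  obtains \<sigma> where "distr M borel Z = distr std_normal_distribution borel (\<lambda>x. \<sigma> * x)"
proof -
  interpret prob_space M by fact
  interpret G: prob_space std_normal_distribution by (rule prob_space_normal_density) simp
  have Z[measurable]: "Z \<in> borel_measurable M" using assms by (simp add: gaussian_rv_def)
  obtain \<mu> where "(\<exists>\<sigma>>0. distributed M lborel Z (normal_density \<mu> \<sigma>)) \<or> (AE \<omega> in M. Z \<omega> = \<mu>)"
    using assms by (auto simp: gaussian_rv_def)
  then show thesis
  proof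
    assume "\<exists>\<sigma>>0. distributed M lborel Z (normal_density \<mu> \<sigma>)"
    then obtain \<sigma> where \<sigma>: "\<sigma> > 0" and Z': "distributed M lborel Z (normal_density \<mu> \<sigma>)" by auto
    have "\<mu> = 0" using normal_distributed_expectation[OF \<sigma> Z'] assms by simp
    then have "distributed M lborel (\<lambda>\<omega>. Z \<omega> / \<sigma>) std_normal_density"
      using Z' normal_standard_normal_convert[OF \<sigma>, of Z \<mu>] by simp
    then have "distr M lborel (\<lambda>\<omega>. Z \<omega> / \<sigma>) = std_normal_distribution"
      by (simp add: distributed_def)
    then have "distr std_normal_distribution borel (\<lambda>x. \<sigma> * x) =
        distr (distr M lborel (\<lambda>\<omega>. Z \<omega> / \<sigma>)) borel (\<lambda>x. \<sigma> * x)" by simp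
    also have "\<dots> = distr M borel Z"
      using \<sigma> by (subst distr_distr) (auto simp: o_def)
    finally show thesis by (rule that[OF sym])
  next
    assume AE: "AE \<omega> in M. Z \<omega> = \<mu>"
    have "integral\<^sup>L M Z = (\<integral>\<omega>. \<mu> \<partial>M)" using AE by (intro integral_cong_AE) auto
    then have "\<mu> = 0" using assms by (simp add: prob_space)
    have "distr M borel Z = distr M borel (\<lambda>_. 0)"
      using AE \<open>\<mu> = 0\<close> by (intro distr_cong_AE) auto
    also have "\<dots> = distr std_normal_distribution borel (\<lambda>x. 0 * x)"
      by (simp add: distr_const G.distr_const)
    finally show thesis using that by blast
  qed
qed

lemma centered_gaussian_moments:
  assumes "prob_space M" "gaussian_rv M Z" "integral\<^sup>L M Z = 0"
  shows "integrable M (\<lambda>\<omega>. (Z \<omega>)\<^sup>2)"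
    and "(\<integral>\<^sup>+\<omega>. ennreal (exp (Z \<omega>)) \<partial>M) = ennreal (exp ((\<integral>\<omega>. (Z \<omega>)\<^sup>2 \<partial>M) / 2))"
    and "(\<integral>\<omega>. iexp (Z \<omega>) \<partial>M) = complex_of_real (exp (- ((\<integral>\<omega>. (Z \<omega>)\<^sup>2 \<partial>M) / 2)))"
proof -
  let ?G = std_normal_distribution
  obtain \<sigma> where d: "distr M borel Z = distr ?G borel (\<lambda>x. \<sigma> * x)"
    using centered_gaussian_distr[OF assms] .
  have Z[measurable]: "Z \<in> borel_measurable M" using assms by (simp add: gaussian_rv_def)
  have "integrable (distr M borel Z) (\<lambda>x. x\<^sup>2)"
    unfolding d by (subst integrable_distr_eq) (auto simp: power_mult_distrib integrable_square_std_normal)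
  then show "integrable M (\<lambda>\<omega>. (Z \<omega>)\<^sup>2)"
    by (subst (asm) integrable_distr_eq) auto
  have "(\<integral>\<omega>. (Z \<omega>)\<^sup>2 \<partial>M) = integral\<^sup>L (distr M borel Z) (\<lambda>x. x\<^sup>2)"
    by (subst integral_distr) auto
  also have "\<dots> = \<sigma>\<^sup>2"
    unfolding d by (subst integral_distr) (auto simp: power_mult_distrib integral_square_std_normal)
  finally have var: "(\<integral>\<omega>. (Z \<omega>)\<^sup>2 \<partial>M) = \<sigma>\<^sup>2" .
  have "(\<integral>\<^sup>+\<omega>. ennreal (exp (Z \<omega>)) \<partial>M) = (\<integral>\<^sup>+x. ennreal (exp x) \<partial>distr M borel Z)"
    by (subst nn_integral_distr) auto
  also have "\<dots> = ennreal (exp (\<sigma>\<^sup>2 / 2))"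
    unfolding d by (subst nn_integral_distr) (auto simp: nn_integral_exp_std_normal)
  finally show "(\<integral>\<^sup>+\<omega>. ennreal (exp (Z \<omega>)) \<partial>M) = ennreal (exp ((\<integral>\<omega>. (Z \<omega>)\<^sup>2 \<partial>M) / 2))"
    by (simp add: var)
  have "(\<integral>\<omega>. iexp (Z \<omega>) \<partial>M) = (\<integral>x. iexp x \<partial>distr M borel Z)"
    by (subst integral_distr) auto
  also have "\<dots> = (\<integral>x. iexp (\<sigma> * x) \<partial>?G)"
    unfolding d by (subst integral_distr) auto
  also have "\<dots> = complex_of_real (exp (- (\<sigma>\<^sup>2 / 2)))"
    using char_std_normal_distribution by (simp add: char_def fun_eq_iff)
  finally show "(\<integral>\<omega>. iexp (Z \<omega>) \<partial>M) = complex_of_real (exp (- ((\<integral>\<omega>. (Z \<omega>)\<^sup>2 \<partial>M) / 2)))"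
    by (simp add: var)
qed

definition centered_gaussian_family :: "'a measure \<Rightarrow> 'i set \<Rightarrow> ('i \<Rightarrow> 'a \<Rightarrow> real) \<Rightarrow> bool" where
  "centered_gaussian_family M I Y \<longleftrightarrow> (\<forall>c. gaussian_rv M (\<lambda>\<omega>. \<Sum>i\<in>I. c i * Y i \<omega>) \<and>
     (\<integral>\<omega>. (\<Sum>i\<in>I. c i * Y i \<omega>) \<partial>M) = 0)"

lemma centered_gaussian_familyD:
  assumes "centered_gaussian_family M I Y" "finite I" "i \<in> I"
  shows "gaussian_rv M (Y i)" "integral\<^sup>L M (Y i) = 0"
proof -
  have "(\<Sum>j\<in>I. of_bool (j = i) * Y j \<omega>) = Y i \<omega>" for \<omega>
    using assms(2,3) by (simp add: of_bool_def if_distrib[of "\<lambda>t. t * _"] cong: if_cong)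
  then show "gaussian_rv M (Y i)" "integral\<^sup>L M (Y i) = 0"
    using assms(1)[unfolded centered_gaussian_family_def, rule_format, of "\<lambda>j. of_bool (j = i)"]
    by simp_all
qed

lemma integrable_mult_of_squares:
  fixes f g :: "'a \<Rightarrow> real"
  assumes "f \<in> borel_measurable M" "g \<in> borel_measurable M"
    "integrable M (\<lambda>x. (f x)\<^sup>2)" "integrable M (\<lambda>x. (g x)\<^sup>2)"
  shows "integrable M (\<lambda>x. f x * g x)"
proof (rule Bochner_Integration.integrable_bound)
  show "integrable M (\<lambda>x. (f x)\<^sup>2 + (g x)\<^sup>2)" using assms by simp
  show "(\<lambda>x. f x * g x) \<in> borel_measurable M" using assms by simp
  have "\<bar>a * b\<bar> \<le> a\<^sup>2 + b\<^sup>2" for a b :: real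
    using sum_squares_bound[of "\<bar>a\<bar>" "\<bar>b\<bar>"] abs_ge_zero[of "a * b"] unfolding abs_mult power2_abs by linarith
  then show "AE x in M. norm (f x * g x) \<le> norm ((f x)\<^sup>2 + (g x)\<^sup>2)" by simp
qed

lemma gaussian_family_variance:
  assumes "prob_space M" "centered_gaussian_family M I Y" "finite I"
  shows "(\<integral>\<omega>. (\<Sum>i\<in>I. c i * Y i \<omega>)\<^sup>2 \<partial>M) = dot I c (mat_app I (\<lambda>i j. \<integral>\<omega>. Y i \<omega> * Y j \<omega> \<partial>M) c)"
proof -
  have int: "integrable M (\<lambda>\<omega>. Y i \<omega> * Y j \<omega>)" if "i \<in> I" "j \<in> I" for i j
    using centered_gaussian_familyD[OF assms(2,3)] that
    by (intro integrable_mult_of_squares centered_gaussian_moments[OF assms(1)]) (auto simp: gaussian_rv_def)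
  have "(\<integral>\<omega>. (\<Sum>i\<in>I. c i * Y i \<omega>)\<^sup>2 \<partial>M) = (\<integral>\<omega>. (\<Sum>i\<in>I. \<Sum>j\<in>I. (c i * c j) * (Y i \<omega> * Y j \<omega>)) \<partial>M)"
    by (simp add: power2_eq_square sum_product mult_ac)
  also have "\<dots> = (\<Sum>i\<in>I. \<Sum>j\<in>I. (c i * c j) * (\<integral>\<omega>. Y i \<omega> * Y j \<omega> \<partial>M))"
    using int by simp
  also have "\<dots> = dot I c (mat_app I (\<lambda>i j. \<integral>\<omega>. Y i \<omega> * Y j \<omega> \<partial>M) c)"
    by (simp add: dot_def mat_app_def sum_distrib_left mult_ac)
  finally show ?thesis .
qed

text \<open>The \<open>Z i\<close> are the coordinates of the vector \<open>Y\<close> in an eigenbasis of its covariance matrix, and the \<open>l i\<close> are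
the eigenvalues. The \<open>Z i\<close> are uncorrelated, so the variance of $\sum_i u_i Z_i$ is $\sum_i l_i u_i^2$; that
linear combination is itself a linear combination of the \<open>Y i\<close> and so Gaussian.\<close>

lemma gaussian_family_principal_components:
  assumes M: "prob_space M" and Y: "centered_gaussian_family M I Y" and fin: "finite I"
    and row: "\<forall>i\<in>I. (\<Sum>j\<in>I. \<bar>\<integral>\<omega>. Y i \<omega> * Y j \<omega> \<partial>M\<bar>) \<le> \<nu>"
  shows "\<exists>Z l. (\<forall>i\<in>I. Z i \<in> borel_measurable M) \<and>
    (\<forall>\<omega>. (\<Sum>i\<in>I. (Z i \<omega>)\<^sup>2) = (\<Sum>i\<in>I. (Y i \<omega>)\<^sup>2)) \<and>
    (\<forall>i\<in>I. 0 \<le> l i \<and> l i \<le> \<nu>) \<and>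
    (\<Sum>i\<in>I. l i) = (\<Sum>i\<in>I. \<integral>\<omega>. Y i \<omega> * Y i \<omega> \<partial>M) \<and>
    (\<forall>u. (\<integral>\<^sup>+\<omega>. ennreal (exp (\<Sum>i\<in>I. u i * Z i \<omega>)) \<partial>M) = ennreal (exp (\<Sum>i\<in>I. l i * (u i)\<^sup>2 / 2))) \<and>
    (\<forall>u. (\<integral>\<omega>. iexp (\<Sum>i\<in>I. u i * Z i \<omega>) \<partial>M) = complex_of_real (exp (- (\<Sum>i\<in>I. l i * (u i)\<^sup>2 / 2))))"
proof -
  define D where "D = (\<lambda>i j. \<integral>\<omega>. Y i \<omega> * Y j \<omega> \<partial>M)"
  have sym: "D a b = D b a" for a b by (simp add: D_def mult.commute)
  obtain v l where v: "orthonormal_family I I v"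
    and eig: "\<And>j a. j \<in> I \<Longrightarrow> a \<in> I \<Longrightarrow> mat_app I D (v j) a = l j * v j a"
    by (rule symmetric_matrix_eigenbasis[OF fin, of D]) (use sym in auto)
  have vv: "dot I (v i) (v j) = of_bool (i = j)" if "i \<in> I" "j \<in> I" for i j
    using v that by (simp add: orthonormal_family_def)
  have Dv: "dot I x (mat_app I D (v i)) = l i * dot I x (v i)" if "i \<in> I" for x i
    using eig[OF that] by (simp add: dot_def sum_distrib_left mult_ac)
  define Z where "Z = (\<lambda>i \<omega>. dot I (v i) (\<lambda>a. Y a \<omega>))"
  define c where "c = (\<lambda>u a. \<Sum>i\<in>I. u i * v i a)"
  have comb: "(\<Sum>i\<in>I. u i * Z i \<omega>) = (\<Sum>a\<in>I. c u a * Y a \<omega>)" for u \<omega>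
    by (simp add: Z_def c_def dot_def sum_distrib_left sum_distrib_right mult_ac) (rule sum.swap)
  have cu: "dot I (c u) (mat_app I D (c u)) = (\<Sum>i\<in>I. l i * (u i)\<^sup>2)" for u
  proof -
    have "dot I (c u) (v i) = u i" if "i \<in> I" for i
    proof -
      have "dot I (c u) (v i) = (\<Sum>j\<in>I. u j * of_bool (j = i))"
        using that vv by (simp add: c_def dot_linear)
      then show ?thesis using that fin by (simp add: of_bool_def if_distrib[of "(*) _"] cong: if_cong)
    qed
    moreover have "dot I (v i) (mat_app I D (c u)) = l i * dot I (c u) (v i)" if "i \<in> I" for i
      using mat_app_symmetric[of I D "v i" "c u"] sym Dv[OF that] by simp
    ultimately have "(\<Sum>i\<in>I. u i * dot I (v i) (mat_app I D (c u))) = (\<Sum>i\<in>I. l i * (u i)\<^sup>2)"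
      by (intro sum.cong refl) (simp add: power2_eq_square)
    then show ?thesis
      by (subst (1) c_def) (simp add: dot_linear)
  qed
  have var: "(\<integral>\<omega>. (\<Sum>a\<in>I. c u a * Y a \<omega>)\<^sup>2 \<partial>M) = (\<Sum>i\<in>I. l i * (u i)\<^sup>2)" for u
    using gaussian_family_variance[OF M Y fin, of "c u"] cu[of u] by (simp add: D_def)
  have gauss: "gaussian_rv M (\<lambda>\<omega>. \<Sum>a\<in>I. x a * Y a \<omega>)" "(\<integral>\<omega>. (\<Sum>a\<in>I. x a * Y a \<omega>) \<partial>M) = 0" for x
    using Y by (auto simp: centered_gaussian_family_def)
  have lv: "l i = dot I (v i) (mat_app I D (v i))" if "i \<in> I" for i
    using Dv[OF that] vv[OF that that] by simp
  show ?thesis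
  proof (rule exI[of _ Z], rule exI[of _ l], intro conjI ballI allI)
    show "Z i \<in> borel_measurable M" if "i \<in> I" for i
      using gauss(1)[of "v i"] by (simp add: Z_def dot_def gaussian_rv_def)
    show "(\<Sum>i\<in>I. (Z i \<omega>)\<^sup>2) = (\<Sum>i\<in>I. (Y i \<omega>)\<^sup>2)" for \<omega>
      unfolding Z_def by (rule sum_squares_orthonormal_coordinates[OF fin v])
    show "0 \<le> l i" if i: "i \<in> I" for i
    proof -
      have "l i = (\<integral>\<omega>. (\<Sum>a\<in>I. v i a * Y a \<omega>)\<^sup>2 \<partial>M)"
        using gaussian_family_variance[OF M Y fin, of "v i"] lv[OF i] by (simp add: D_def)
      then show ?thesis by simp
    qed
    show "l i \<le> \<nu>" if i: "i \<in> I" for i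
      using quadratic_form_le_row_sum[of I D \<nu> "v i", OF fin sym] row lv[OF i] vv[OF i i]
      by (simp add: D_def)
    show "(\<Sum>i\<in>I. l i) = (\<Sum>i\<in>I. \<integral>\<omega>. Y i \<omega> * Y i \<omega> \<partial>M)"
      using sum_eigenbasis_trace[OF fin v, of D] lv by (simp add: D_def)
    show "(\<integral>\<^sup>+\<omega>. ennreal (exp (\<Sum>i\<in>I. u i * Z i \<omega>)) \<partial>M) = ennreal (exp (\<Sum>i\<in>I. l i * (u i)\<^sup>2 / 2))" for u
      using centered_gaussian_moments(2)[OF M gauss] var[of u] by (simp add: comb sum_divide_distrib)
    show "(\<integral>\<omega>. iexp (\<Sum>i\<in>I. u i * Z i \<omega>) \<partial>M) = complex_of_real (exp (- (\<Sum>i\<in>I. l i * (u i)\<^sup>2 / 2)))" for u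
      using centered_gaussian_moments(3)[OF M gauss] var[of u] by (simp only: comb sum_divide_distrib)
  qed
qed

section \<open>Tail bounds for Gaussian quadratic forms\<close>

text \<open>Convexity of \<open>exp\<close> between $0$ and $\ln (1 + x)$.\<close>

lemma bernoulli_powr_le:
  fixes x \<theta> :: real
  assumes "-1 < x" "0 \<le> \<theta>" "\<theta> \<le> 1"
  shows "(1 + x) powr \<theta> \<le> 1 + \<theta> * x"
proof -
  have "exp ((1 - \<theta>) *\<^sub>R 0 + \<theta> *\<^sub>R ln (1 + x)) \<le> (1 - \<theta>) * exp 0 + \<theta> * exp (ln (1 + x))"
    using assms by (intro convex_onD[OF exp_convex]) auto
  then show ?thesis using assms by (simp add: powr_def algebra_simps)
qed

text \<open>Among eigenvalues in $[0,\nu]$ with a given sum, the product is largest when as many as possible equal $\nu$.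
With $x = -s$ and $x = s$ this serves the upper and the lower tail.\<close>

lemma prod_inverse_sqrt_le:
  fixes l :: "'i \<Rightarrow> real"
  assumes "-1 < x" "0 < \<nu>" "\<And>i. i \<in> I \<Longrightarrow> 0 \<le> l i \<and> l i \<le> \<nu>"
  shows "(\<Prod>i\<in>I. 1 / sqrt (1 + x / \<nu> * l i)) \<le> (1 + x) powr (- (\<Sum>i\<in>I. l i) / (2 * \<nu>))"
proof -
  have "(\<Prod>i\<in>I. 1 / sqrt (1 + x / \<nu> * l i)) \<le> (\<Prod>i\<in>I. (1 + x) powr (- l i / (2 * \<nu>)))"
  proof (intro prod_mono conjI)
    fix i assume i: "i \<in> I"
    have pos: "0 < (1 + x) powr (l i / \<nu>)" using assms by simp
    have le: "(1 + x) powr (l i / \<nu>) \<le> 1 + x / \<nu> * l i"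
      using bernoulli_powr_le[of x "l i / \<nu>"] assms i by (simp add: field_simps)
    have "0 \<le> 1 + x / \<nu> * l i" using le pos by linarith
    then show "0 \<le> 1 / sqrt (1 + x / \<nu> * l i)" by simp
    have "1 / sqrt (1 + x / \<nu> * l i) \<le> 1 / sqrt ((1 + x) powr (l i / \<nu>))"
      using le pos by (intro divide_left_mono mult_pos_pos) (auto simp del: powr_gt_zero)
    also have "sqrt ((1 + x) powr (l i / \<nu>)) = (1 + x) powr (l i / (2 * \<nu>))"
      using assms by (intro real_sqrt_unique) (auto simp: power2_eq_square powr_add[symmetric] add_divide_distrib[symmetric])
    also have "1 / (1 + x) powr (l i / (2 * \<nu>)) = (1 + x) powr (- l i / (2 * \<nu>))"
      by (simp add: powr_minus_divide)
    finally show "1 / sqrt (1 + x / \<nu> * l i) \<le> (1 + x) powr (- l i / (2 * \<nu>))" .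
  qed
  also have "\<dots> = (1 + x) powr (\<Sum>i\<in>I. - l i / (2 * \<nu>))"
    using assms(1) by (cases "finite I") (simp_all add: powr_sum)
  also have "(\<Sum>i\<in>I. - l i / (2 * \<nu>)) = - (\<Sum>i\<in>I. l i) / (2 * \<nu>)"
    by (simp add: sum_divide_distrib sum_negf)
  finally show ?thesis .
qed

lemma gaussian_quadratic_mgf:
  assumes M: "prob_space M" and Y: "centered_gaussian_family M I Y" and fin: "finite I"
    and row: "\<And>i. i \<in> I \<Longrightarrow> (\<Sum>j\<in>I. \<bar>\<integral>\<omega>. Y i \<omega> * Y j \<omega> \<partial>M\<bar>) \<le> \<nu>" and \<nu>: "0 < \<nu>"
    and tr: "\<tau> = (\<Sum>i\<in>I. \<integral>\<omega>. Y i \<omega> * Y i \<omega> \<partial>M)"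
    and s: "0 \<le> s"
  shows "s < 1 \<Longrightarrow> (\<integral>\<^sup>+\<omega>. ennreal (exp (s / (2 * \<nu>) * (\<Sum>i\<in>I. (Y i \<omega>)\<^sup>2))) \<partial>M) \<le>
      ennreal ((1 - s) powr (- \<tau> / (2 * \<nu>)))"
    and "(\<integral>\<omega>. exp (- (s / (2 * \<nu>) * (\<Sum>i\<in>I. (Y i \<omega>)\<^sup>2))) \<partial>M) \<le> (1 + s) powr (- \<tau> / (2 * \<nu>))"
proof -
  interpret prob_space M by fact
  have row': "\<forall>i\<in>I. (\<Sum>j\<in>I. \<bar>\<integral>\<omega>. Y i \<omega> * Y j \<omega> \<partial>M\<bar>) \<le> \<nu>" using row by blast
  obtain Z l where Z: "\<forall>i\<in>I. Z i \<in> borel_measurable M"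
    "\<forall>\<omega>. (\<Sum>i\<in>I. (Z i \<omega>)\<^sup>2) = (\<Sum>i\<in>I. (Y i \<omega>)\<^sup>2)"
    and l: "\<forall>i\<in>I. 0 \<le> l i \<and> l i \<le> \<nu>"
    and lt: "(\<Sum>i\<in>I. l i) = \<tau>"
    and mgf: "\<forall>u. (\<integral>\<^sup>+\<omega>. ennreal (exp (\<Sum>i\<in>I. u i * Z i \<omega>)) \<partial>M) = ennreal (exp (\<Sum>i\<in>I. l i * (u i)\<^sup>2 / 2))"
    and char: "\<forall>u. (\<integral>\<omega>. iexp (\<Sum>i\<in>I. u i * Z i \<omega>) \<partial>M) = complex_of_real (exp (- (\<Sum>i\<in>I. l i * (u i)\<^sup>2 / 2)))"
    using gaussian_family_principal_components[OF M Y fin row'] unfolding tr[symmetric]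
    by (elim exE conjE) (rule that; assumption)
  note Z = Z[rule_format] and l = l[rule_format] and mgf = mgf[rule_format] and char = char[rule_format]
  define t where "t = s / (2 * \<nu>)"
  have t: "0 \<le> t" "2 * t = s / \<nu>" using s \<nu> by (simp_all add: t_def)
  {
    assume s1: "s < 1"
    have lt1: "2 * t * l i < 1" if "i \<in> I" for i
    proof -
      have "l i / \<nu> \<le> 1" using l[OF that] \<nu> by simp
      then have "s * (l i / \<nu>) \<le> s" using s mult_left_le by blast
      then have "2 * t * l i \<le> s" by (simp add: t)
      with s1 show ?thesis by simp
    qed
    have "(\<integral>\<^sup>+\<omega>. ennreal (exp (t * (\<Sum>i\<in>I. (Z i \<omega>)\<^sup>2))) \<partial>M) = ennreal (\<Prod>i\<in>I. 1 / sqrt (1 - 2 * t * l i))"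
      by (rule nn_integral_exp_sum_squares[OF sigma_finite_measure_axioms fin Z(1) mgf t(1) lt1])
    also have "\<dots> \<le> ennreal ((1 - s) powr (- \<tau> / (2 * \<nu>)))"
      using prod_inverse_sqrt_le[of "-s" \<nu> I l] s1 \<nu> l t lt by (intro ennreal_leI) simp
    finally show "(\<integral>\<^sup>+\<omega>. ennreal (exp (s / (2 * \<nu>) * (\<Sum>i\<in>I. (Y i \<omega>)\<^sup>2))) \<partial>M) \<le>
      ennreal ((1 - s) powr (- \<tau> / (2 * \<nu>)))" by (simp only: Z t_def)
  }
  have "(\<integral>\<omega>. exp (- (t * (\<Sum>i\<in>I. (Z i \<omega>)\<^sup>2))) \<partial>M) = (\<Prod>i\<in>I. 1 / sqrt (1 + 2 * t * l i))"
    using l by (intro integral_exp_neg_sum_squares[OF finite_measure_axioms fin Z(1) char t(1)]) auto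
  also have "\<dots> \<le> (1 + s) powr (- \<tau> / (2 * \<nu>))"
    using prod_inverse_sqrt_le[of s \<nu> I l] s \<nu> l t lt by simp
  finally show "(\<integral>\<omega>. exp (- (s / (2 * \<nu>) * (\<Sum>i\<in>I. (Y i \<omega>)\<^sup>2))) \<partial>M) \<le> (1 + s) powr (- \<tau> / (2 * \<nu>))"
    by (simp only: Z t_def)
qed

text \<open>Chernoff's bound with the optimal parameter: for $w = b/A$, the exponent $A(-\ln(1-s) - s) - s b$ is minimal
at $s = w/(1+w)$. Replacing $\tau$ by its upper bound $A$ is harmless because its coefficient $-\ln(1-s) - s$ is
nonnegative.\<close>

lemma gaussian_quadratic_upper_tail:
  assumes M: "prob_space M" and Y: "centered_gaussian_family M I Y" and fin: "finite I"
    and row: "\<And>i. i \<in> I \<Longrightarrow> (\<Sum>j\<in>I. \<bar>\<integral>\<omega>. Y i \<omega> * Y j \<omega> \<partial>M\<bar>) \<le> \<nu>" and \<nu>: "0 < \<nu>"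
    and tr: "\<tau> = (\<Sum>i\<in>I. \<integral>\<omega>. Y i \<omega> * Y i \<omega> \<partial>M)"
    and A: "\<tau> \<le> A" "0 < A" and b: "0 < b"
  shows "measure M {\<omega> \<in> space M. \<tau> + b \<le> (\<Sum>i\<in>I. (Y i \<omega>)\<^sup>2)} \<le>
    exp (- b / (2 * \<nu>)) * (1 + b / A) powr (A / (2 * \<nu>))"
proof -
  interpret prob_space M by fact
  have [measurable]: "Y i \<in> borel_measurable M" if "i \<in> I" for i
    using centered_gaussian_familyD(1)[OF Y fin that] by (simp add: gaussian_rv_def)
  define Q where "Q = (\<lambda>\<omega>. \<Sum>i\<in>I. (Y i \<omega>)\<^sup>2)"
  have [measurable]: "Q \<in> borel_measurable M" unfolding Q_def by measurable
  define s where "s = (b / A) / (1 + b / A)"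
  have s: "0 < s" "s < 1" using A b by (simp_all add: s_def field_simps)
  have sb: "s * (A + b) = b" using A b by (simp add: s_def field_simps)
  have "1 - s = 1 / (1 + b / A)" using A b by (simp add: s_def field_simps)
  then have L: "ln (1 - s) = - ln (1 + b / A)" using A b by (simp add: ln_div)
  have sL: "s \<le> ln (1 + b / A)" using ln_le_minus_one[of "1 - s"] s L by simp
  define c where "c = s / (2 * \<nu>)"
  have c: "0 < c" using s \<nu> by (simp add: c_def)
  let ?E = "{\<omega> \<in> space M. \<tau> + b \<le> Q \<omega>}"
  have "ennreal (prob ?E) = (\<integral>\<^sup>+\<omega>. indicator ?E \<omega> \<partial>M)"
    by (simp add: emeasure_eq_measure)
  also have "\<dots> \<le> (\<integral>\<^sup>+\<omega>. ennreal (exp (- (c * (\<tau> + b)))) * ennreal (exp (c * Q \<omega>)) \<partial>M)"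
  proof (intro nn_integral_mono)
    fix \<omega>
    have "1 \<le> exp (c * (Q \<omega> - (\<tau> + b)))" if "\<omega> \<in> ?E" using that c by simp
    then show "indicator ?E \<omega> \<le> ennreal (exp (- (c * (\<tau> + b)))) * ennreal (exp (c * Q \<omega>))"
      by (auto simp: ennreal_mult'[symmetric] mult_exp_exp right_diff_distrib indicator_def)
  qed
  also have "\<dots> = ennreal (exp (- (c * (\<tau> + b)))) * (\<integral>\<^sup>+\<omega>. ennreal (exp (c * Q \<omega>)) \<partial>M)"
    by (intro nn_integral_cmult) measurable
  also have "\<dots> \<le> ennreal (exp (- (c * (\<tau> + b)))) * ennreal ((1 - s) powr (- \<tau> / (2 * \<nu>)))"
    using gaussian_quadratic_mgf(1)[OF M Y fin row \<nu> tr, of s] s unfolding c_def Q_def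
    by (intro mult_left_mono) auto
  also have "\<dots> = ennreal (exp (- (c * (\<tau> + b))) * (1 - s) powr (- \<tau> / (2 * \<nu>)))"
    by (simp add: ennreal_mult')
  finally have "prob ?E \<le> exp (- (c * (\<tau> + b))) * (1 - s) powr (- \<tau> / (2 * \<nu>))"
    by (subst (asm) ennreal_le_iff) auto
  also have "\<dots> = exp ((\<tau> * (ln (1 + b / A) - s) - s * b) / (2 * \<nu>))"
    using s \<nu> by (simp add: powr_def L mult_exp_exp c_def field_simps)
  also have "\<dots> \<le> exp ((A * (ln (1 + b / A) - s) - s * b) / (2 * \<nu>))"
    using \<nu> A sL by (simp add: divide_right_mono mult_right_mono)
  also have "A * (ln (1 + b / A) - s) - s * b = A * ln (1 + b / A) - b"
    using sb by (simp add: algebra_simps)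
  also have "exp ((A * ln (1 + b / A) - b) / (2 * \<nu>)) = exp (- b / (2 * \<nu>)) * (1 + b / A) powr (A / (2 * \<nu>))"
    using A b by (simp add: powr_def mult_exp_exp add_pos_pos diff_divide_distrib less_imp_neq[symmetric])
  finally show ?thesis by (simp add: Q_def)
qed

text \<open>As for the upper tail, with the exponent $A(s - \ln(1+s)) - s b$, which is minimal at $s = w/(1-w)$ for
$w = b/A < 1$.\<close>

lemma gaussian_quadratic_lower_tail:
  assumes M: "prob_space M" and Y: "centered_gaussian_family M I Y" and fin: "finite I"
    and row: "\<And>i. i \<in> I \<Longrightarrow> (\<Sum>j\<in>I. \<bar>\<integral>\<omega>. Y i \<omega> * Y j \<omega> \<partial>M\<bar>) \<le> \<nu>" and \<nu>: "0 < \<nu>"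
    and tr: "\<tau> = (\<Sum>i\<in>I. \<integral>\<omega>. Y i \<omega> * Y i \<omega> \<partial>M)"
    and A: "\<tau> \<le> A" and b: "0 < b" "b < A"
  shows "measure M {\<omega> \<in> space M. (\<Sum>i\<in>I. (Y i \<omega>)\<^sup>2) \<le> \<tau> - b} \<le>
    exp (b / (2 * \<nu>)) * (1 - b / A) powr (A / (2 * \<nu>))"
proof -
  interpret prob_space M by fact
  have [measurable]: "Y i \<in> borel_measurable M" if "i \<in> I" for i
    using centered_gaussian_familyD(1)[OF Y fin that] by (simp add: gaussian_rv_def)
  define Q where "Q = (\<lambda>\<omega>. \<Sum>i\<in>I. (Y i \<omega>)\<^sup>2)"
  have [measurable]: "Q \<in> borel_measurable M" unfolding Q_def by measurable
  have Q0: "0 \<le> Q \<omega>" for \<omega> by (simp add: Q_def sum_nonneg)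
  have wA: "b / A < 1" "0 < b / A" using b by simp_all
  define s where "s = (b / A) / (1 - b / A)"
  have s: "0 < s" using divide_pos_pos[OF wA(2), of "1 - b / A"] wA(1) by (simp add: s_def)
  have sb: "s * (A - b) = b" using b by (simp add: s_def field_simps)
  have "1 + s = 1 / (1 - b / A)" using b by (simp add: s_def field_simps)
  then have L: "ln (1 + s) = - ln (1 - b / A)" using wA by (simp add: ln_div)
  have sL: "ln (1 + s) \<le> s" using ln_le_minus_one[of "1 + s"] s by simp
  define c where "c = s / (2 * \<nu>)"
  have c: "0 < c" using s \<nu> by (simp add: c_def)
  let ?E = "{\<omega> \<in> space M. Q \<omega> \<le> \<tau> - b}"
  have int: "integrable M (\<lambda>\<omega>. exp (- (c * Q \<omega>)))"
    using Q0 c by (intro integrable_const_bound[where B = 1]) auto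
  have "prob ?E = (\<integral>\<omega>. indicator ?E \<omega> \<partial>M)" by simp
  also have "\<dots> \<le> (\<integral>\<omega>. exp (c * (\<tau> - b)) * exp (- (c * Q \<omega>)) \<partial>M)"
  proof (intro integral_mono integrable_mult_right int)
    show "integrable M (indicat_real ?E)" by (simp add: less_top[symmetric])
    fix \<omega>
    have "1 \<le> exp (c * ((\<tau> - b) - Q \<omega>))" if "\<omega> \<in> ?E" using that c by simp
    then show "indicat_real ?E \<omega> \<le> exp (c * (\<tau> - b)) * exp (- (c * Q \<omega>))"
      by (auto simp: mult_exp_exp right_diff_distrib indicator_def)
  qed
  also have "\<dots> = exp (c * (\<tau> - b)) * (\<integral>\<omega>. exp (- (c * Q \<omega>)) \<partial>M)" by simp
  also have "\<dots> \<le> exp (c * (\<tau> - b)) * (1 + s) powr (- \<tau> / (2 * \<nu>))"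
    using gaussian_quadratic_mgf(2)[OF M Y fin row \<nu> tr, of s] s unfolding c_def Q_def
    by (intro mult_left_mono) auto
  also have "\<dots> = exp ((\<tau> * (s - ln (1 + s)) - s * b) / (2 * \<nu>))"
    using s \<nu> by (simp add: powr_def mult_exp_exp c_def field_simps)
  also have "\<dots> \<le> exp ((A * (s - ln (1 + s)) - s * b) / (2 * \<nu>))"
    using \<nu> A sL by (simp add: divide_right_mono mult_right_mono)
  also have "A * (s - ln (1 + s)) - s * b = A * ln (1 - b / A) + b"
    using sb by (simp add: algebra_simps L)
  also have "exp ((A * ln (1 - b / A) + b) / (2 * \<nu>)) = exp (b / (2 * \<nu>)) * (1 - b / A) powr (A / (2 * \<nu>))"
    using wA b by (simp add: powr_def mult_exp_exp add_divide_distrib add.commute)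
  finally show ?thesis by (simp add: Q_def)
qed

section \<open>The quantiles\<close>

lemma ln_add_minus_less:
  fixes a b :: real
  assumes "0 \<le> a" "a < b"
  shows "ln (1 + b) - b < ln (1 + a) - a"
proof -
  have "ln ((1 + b) / (1 + a)) < (1 + b) / (1 + a) - 1"
    using ln_le_minus_one[of "(1 + b) / (1 + a)"] ln_eq_minus_one[of "(1 + b) / (1 + a)"] assms
    by (auto simp: less_le)
  also have "\<dots> = (b - a) / (1 + a)" using assms by (simp add: field_simps)
  also have "\<dots> \<le> (b - a) / 1" using assms by (intro divide_left_mono) auto
  finally show ?thesis using assms by (simp add: ln_div)
qed

lemma ln_diff_plus_less:
  fixes a b :: real
  assumes "0 \<le> a" "a < b" "b < 1"
  shows "ln (1 - b) + b < ln (1 - a) + a"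
proof -
  have "ln ((1 - b) / (1 - a)) < (1 - b) / (1 - a) - 1"
    using ln_le_minus_one[of "(1 - b) / (1 - a)"] ln_eq_minus_one[of "(1 - b) / (1 - a)"] assms
    by (auto simp: less_le)
  also have "\<dots> = - ((b - a) / (1 - a))" using assms by (simp add: field_simps)
  also have "\<dots> \<le> - ((b - a) / 1)"
    using assms by (intro le_imp_neg_le divide_left_mono) auto
  finally show ?thesis using assms by (simp add: ln_div)
qed

text \<open>Up to rescaling, the logarithms of $\varphi_{r,n}$ and $\varphi_{l,n}$ are $\ln(1+w) - w$ and $\ln(1-w) + w$.
Both decrease strictly from $0$ to $-\infty$, on $(0,\infty)$ and $(0,1)$ respectively.\<close>

lemma ex1_ln_add_minus:
  fixes y :: real
  assumes "y < 0"
  shows "\<exists>!w. 0 < w \<and> ln (1 + w) - w = y"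
proof -
  have "filterlim (\<lambda>w::real. ln (1 + w) - w) at_bot at_top" by real_asymp
  then have "eventually (\<lambda>w. ln (1 + w) - w \<le> y \<and> 0 < w) at_top"
    by (intro eventually_conj eventually_gt_at_top) (simp add: filterlim_at_bot)
  then obtain b where b: "ln (1 + b) - b \<le> y" "0 < b"
    by (auto dest: eventually_happens)
  have "\<exists>w. 0 \<le> w \<and> w \<le> b \<and> ln (1 + w) - w = y"
    using b assms by (intro IVT2') (auto intro!: continuous_intros)
  then obtain w where w: "0 < w" "ln (1 + w) - w = y" using assms by (auto simp: le_less)
  show ?thesis
  proof (intro ex1I[of _ w] conjI w)
    fix z assume "0 < z \<and> ln (1 + z) - z = y"
    then show "z = w"
      using ln_add_minus_less[of z w] ln_add_minus_less[of w z] w by (cases z w rule: linorder_cases) auto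
  qed
qed

lemma ex1_ln_diff_plus:
  fixes y :: real
  assumes "y < 0"
  shows "\<exists>!w. 0 < w \<and> w < 1 \<and> ln (1 - w) + w = y"
proof -
  have "filterlim (\<lambda>w::real. ln (1 - w) + w) at_bot (at_left 1)" by real_asymp
  then have "eventually (\<lambda>w. ln (1 - w) + w \<le> y \<and> w \<in> {0<..<1}) (at_left 1)"
    by (intro eventually_conj eventually_at_left_real) (simp_all add: filterlim_at_bot)
  then obtain b where b: "ln (1 - b) + b \<le> y" "0 < b" "b < 1"
    by (auto dest!: eventually_happens)
  have "\<exists>w. 0 \<le> w \<and> w \<le> b \<and> ln (1 - w) + w = y"
    using b assms by (intro IVT2') (auto intro!: continuous_intros)
  then obtain w where w: "0 < w" "w < 1" "ln (1 - w) + w = y" using assms b by (auto simp: le_less)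
  show ?thesis
  proof (intro ex1I[of _ w] conjI w)
    fix z assume "0 < z \<and> z < 1 \<and> ln (1 - z) + z = y"
    then show "z = w"
      using ln_diff_plus_less[of z w] ln_diff_plus_less[of w z] w by (cases z w rule: linorder_cases) auto
  qed
qed

lemma the_inv_into_ex1:
  assumes "\<exists>!x. x \<in> A \<and> f x = y"
  shows "the_inv_into A f y \<in> A" "f (the_inv_into A f y) = y"
  using theI'[OF assms] by (simp_all add: the_inv_into_def)

lemma ex1_rescale:
  fixes c :: real
  assumes "\<exists>!w. P w" "c \<noteq> 0"
  shows "\<exists>!z. P (z / c)"
proof -
  obtain w where w: "P w" "\<And>w'. P w' \<Longrightarrow> w' = w" using assms(1) by blast
  show ?thesis
  proof (intro ex1I[of _ "w * c"])
    show "P (w * c / c)" using w(1) assms(2) by simp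
    fix z assume "P (z / c)"
    then show "z = w * c" using w(2)[of "z / c"] assms(2) by (simp add: field_simps)
  qed
qed

lemma q_r_solves:
  assumes n: "n \<ge> 2" and "0 < \<nu>" "0 \<le> e" "0 < a" "a < 1"
  shows "0 < q_r n \<nu> e a" "phi_r n \<nu> e (q_r n \<nu> e a) = a"
proof -
  define c where "c = (e + 1) * sqrt (real n - 1)"
  define K where "K = (e + 1) * (real n - 1) / (2 * \<nu>)"
  have c: "c > 0" and K: "K > 0" using assms by (simp_all add: c_def K_def)
  have Kc: "K * (z / c) = z * sqrt (real n - 1) / (2 * \<nu>)" for z
  proof -
    have "real n - 1 = sqrt (real n - 1) * sqrt (real n - 1)" using n by simp
    then have "K = c * sqrt (real n - 1) / (2 * \<nu>)" unfolding K_def c_def by (simp only: mult.assoc)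
    then show ?thesis using c by simp
  qed
  have eq: "phi_r n \<nu> e z = exp (K * (ln (1 + z / c) - z / c))" if "z > 0" for z
  proof -
    have "1 + z / c > 0" using that c by (simp add: add_pos_pos)
    then have "phi_r n \<nu> e z = exp (- (K * (z / c))) * exp (K * ln (1 + z / c))"
      by (simp add: phi_r_def Kc powr_def c_def[symmetric] K_def[symmetric] del: times_divide_eq_right)
    then show ?thesis by (simp add: mult_exp_exp right_diff_distrib)
  qed
  have "(phi_r n \<nu> e z = a) = (ln (1 + z / c) - z / c = ln a / K)" if "z > 0" for z
  proof -
    have "(phi_r n \<nu> e z = a) = (K * (ln (1 + z / c) - z / c) = ln a)"
      using eq[OF that] assms by (metis exp_ln ln_exp)
    then show ?thesis using K by (simp add: field_simps)
  qed
  then have iff: "z \<in> {0<..} \<and> phi_r n \<nu> e z = a \<longleftrightarrow> 0 < z / c \<and> ln (1 + z / c) - z / c = ln a / K" for z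
    using c by (auto simp: zero_less_divide_iff)
  have "\<exists>!z. z \<in> {0<..} \<and> phi_r n \<nu> e z = a"
    unfolding iff using assms K c by (intro ex1_rescale ex1_ln_add_minus) (auto simp: divide_neg_pos)
  from the_inv_into_ex1[OF this] show "0 < q_r n \<nu> e a" "phi_r n \<nu> e (q_r n \<nu> e a) = a"
    by (simp_all add: q_r_def)
qed

lemma q_l_solves:
  assumes n: "n \<ge> 2" and "0 < \<nu>" "0 \<le> e" "0 < a" "a < 1"
  shows "0 < q_l n \<nu> e a" "q_l n \<nu> e a < (e + 1) * sqrt (real n - 1)" "phi_l n \<nu> e (q_l n \<nu> e a) = a"
proof -
  define c where "c = (e + 1) * sqrt (real n - 1)"
  define K where "K = (e + 1) * (real n - 1) / (2 * \<nu>)"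
  have c: "c > 0" and K: "K > 0" using assms by (simp_all add: c_def K_def)
  have Kc: "K * (z / c) = z * sqrt (real n - 1) / (2 * \<nu>)" for z
  proof -
    have "real n - 1 = sqrt (real n - 1) * sqrt (real n - 1)" using n by simp
    then have "K = c * sqrt (real n - 1) / (2 * \<nu>)" unfolding K_def c_def by (simp only: mult.assoc)
    then show ?thesis using c by simp
  qed
  have eq: "phi_l n \<nu> e z = exp (K * (ln (1 - z / c) + z / c))" if "z > 0" "z < c" for z
  proof -
    have "1 - z / c > 0" using that c by simp
    then have "phi_l n \<nu> e z = exp (K * (z / c)) * exp (K * ln (1 - z / c))"
      using that by (simp add: phi_l_def Kc powr_def c_def[symmetric] K_def[symmetric] del: times_divide_eq_right)
    then show ?thesis by (simp add: mult_exp_exp distrib_left add.commute)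
  qed
  have "(phi_l n \<nu> e z = a) = (ln (1 - z / c) + z / c = ln a / K)" if "z > 0" "z < c" for z
  proof -
    have "(phi_l n \<nu> e z = a) = (K * (ln (1 - z / c) + z / c) = ln a)"
      using eq[OF that] assms by (metis exp_ln ln_exp)
    then show ?thesis using K by (simp add: field_simps)
  qed
  then have iff: "z \<in> {0<..<c} \<and> phi_l n \<nu> e z = a \<longleftrightarrow>
      0 < z / c \<and> z / c < 1 \<and> ln (1 - z / c) + z / c = ln a / K" for z
    using c by (auto simp: zero_less_divide_iff)
  have "\<exists>!z. z \<in> {0<..<c} \<and> phi_l n \<nu> e z = a"
    unfolding iff using assms K c by (intro ex1_rescale ex1_ln_diff_plus) (auto simp: divide_neg_pos)
  from the_inv_into_ex1[OF this]
  show "0 < q_l n \<nu> e a" "q_l n \<nu> e a < (e + 1) * sqrt (real n - 1)" "phi_l n \<nu> e (q_l n \<nu> e a) = a"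
    by (simp_all add: q_l_def c_def)
qed

section \<open>Inverting the normalization\<close>

lemma four_minus_powr_pos: "x < 1 \<Longrightarrow> 0 < 4 - 2 powr (2 * x :: real)"
  using powr_less_mono[of "2 * x" 2 2] by simp

lemma g_fun_strict_mono:
  assumes "0 < T" "T < real n" "a < b" "b < 1"
  shows "g_fun n T a < g_fun n T b"
proof -
  have "ln (real n / T) > 0" using assms by simp
  then have "2 * a * ln (real n / T) < 2 * b * ln (real n / T)" using assms by simp
  moreover have "ln (4 - 2 powr (2 * b)) < ln (4 - 2 powr (2 * a))"
    using four_minus_powr_pos[of a] four_minus_powr_pos[of b] assms by simp
  ultimately show ?thesis by (simp add: g_fun_def)
qed

lemma g_fun_0: "g_fun n T 0 = - ln 3"
  by (simp add: g_fun_def)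

text \<open>The function increases strictly from $-\ln 3$ at $0$ and is unbounded near $1$, where $4 - 2^{2x}$ tends
to $0$.\<close>

lemma ex1_g_fun:
  assumes "0 < T" "T < real n" "- ln 3 < y"
  shows "\<exists>!x. x \<in> {0<..<1} \<and> g_fun n T x = y"
proof -
  have L: "ln (real n / T) > 0" using assms by simp
  \<comment> \<open>A point \<open>b\<close> with $g(b) \ge y$: choose it so that $4 - 2^{2b} = \delta$ with $-\ln \delta \ge y$.\<close>
  define \<delta> where "\<delta> = min (exp (- y)) 1"
  have \<delta>: "0 < \<delta>" "\<delta> \<le> 1" "\<delta> \<le> exp (- y)" by (simp_all add: \<delta>_def)
  define b where "b = log 2 (4 - \<delta>) / 2"
  have "log 2 (4 - \<delta>) < log 2 4" "log 2 1 < log 2 (4 - \<delta>)" using \<delta> by simp_all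
  moreover have "log 2 (4::real) = 2" using log_pow_cancel[of 2 2] by simp
  ultimately have b: "0 < b" "b < 1" by (simp_all add: b_def)
  have "y \<le> - ln \<delta>" using ln_mono[of \<delta> "exp (- y)"] \<delta> by simp
  also have "4 - 2 powr (2 * b) = \<delta>" using \<delta> by (simp add: b_def)
  then have "- ln \<delta> \<le> g_fun n T b" using L b by (simp add: g_fun_def)
  finally have b: "y \<le> g_fun n T b" "0 < b" "b < 1" using b by simp_all
  have "4 - 2 powr (2 * x) \<noteq> 0" if "x \<in> {0..b}" for x
    using four_minus_powr_pos[of x] that b by simp
  then have "continuous_on {0..b} (g_fun n T)"
    unfolding g_fun_def by (intro continuous_intros) auto
  then have "\<exists>x. 0 \<le> x \<and> x \<le> b \<and> g_fun n T x = y"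
    using b assms by (intro IVT') (auto simp: g_fun_0)
  then obtain x where x: "0 < x" "x < 1" "g_fun n T x = y"
    using b assms g_fun_0[of n T] by (auto simp: le_less)
  show ?thesis
  proof (intro ex1I[of _ x])
    fix z assume "z \<in> {0<..<1} \<and> g_fun n T z = y"
    then show "z = x"
      using g_fun_strict_mono[OF assms(1,2), of z x] g_fun_strict_mono[OF assms(1,2), of x z] x
      by (cases z x rule: linorder_cases) auto
  qed (use x in auto)
qed

text \<open>For $\gamma$ inside $(0,1)$ the extension of $g^{-1}$ by the boundary values $0$ and $1$ keeps it adjoint to
$g$ on both sides, for every extended real \<open>y\<close>.\<close>

lemma
  assumes T: "0 < T" "T < real n" and \<gamma>: "0 < \<gamma>" "\<gamma> < 1"
  shows g_inv_le_iff: "g_inv n T y \<le> \<gamma> \<longleftrightarrow> y \<le> ereal (g_fun n T \<gamma>)"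
    and le_g_inv_iff: "\<gamma> \<le> g_inv n T y \<longleftrightarrow> ereal (g_fun n T \<gamma>) \<le> y"
proof -
  have g: "- ln 3 < g_fun n T \<gamma>"
    using g_fun_strict_mono[OF T, of 0 \<gamma>] \<gamma> by (simp add: g_fun_0)
  have "(g_inv n T y \<le> \<gamma> \<longleftrightarrow> y \<le> ereal (g_fun n T \<gamma>)) \<and> (\<gamma> \<le> g_inv n T y \<longleftrightarrow> ereal (g_fun n T \<gamma>) \<le> y)"
  proof (cases "y \<le> ereal (- ln 3)")
    case True
    have lt: "ereal (- ln 3) < ereal (g_fun n T \<gamma>)" using g by simp
    then have "y < ereal (g_fun n T \<gamma>)" using True by (rule le_less_trans[rotated])
    then show ?thesis using True \<gamma> by (simp add: g_inv_def not_le)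
  next
    case False
    show ?thesis
    proof (cases y)
      case (real r)
      define x where "x = g_inv n T y"
      have x_eq: "x = the_inv_into {0<..<1} (g_fun n T) r" using real False by (simp add: x_def g_inv_def)
      have r: "- ln 3 < r" using real False by simp
      have x: "0 < x" "x < 1" "g_fun n T x = r"
        using the_inv_into_ex1[OF ex1_g_fun[OF T r]] by (simp_all add: x_eq)
      show ?thesis
        unfolding x_def[symmetric] unfolding real ereal_less_eq(3)
        using g_fun_strict_mono[OF T, of x \<gamma>] g_fun_strict_mono[OF T, of \<gamma> x] x \<gamma>
        by (cases x \<gamma> rule: linorder_cases) auto
    qed (use False \<gamma> in \<open>auto simp: g_inv_def\<close>)
  qed
  then show "g_inv n T y \<le> \<gamma> \<longleftrightarrow> y \<le> ereal (g_fun n T \<gamma>)" "\<gamma> \<le> g_inv n T y \<longleftrightarrow> ereal (g_fun n T \<gamma>) \<le> y"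
    by auto
qed

lemma
  shows ln_star_le_iff: "ln_star p \<le> ereal r \<longleftrightarrow> p \<le> ereal (exp r)"
    and le_ln_star_iff: "ereal r \<le> ln_star p \<longleftrightarrow> ereal (exp r) \<le> p"
proof -
  have *: "exp r > 0" by simp
  have "(ln_star p \<le> ereal r \<longleftrightarrow> p \<le> ereal (exp r)) \<and> (ereal r \<le> ln_star p \<longleftrightarrow> ereal (exp r) \<le> p)"
  proof (cases p)
    case (real x)
    show ?thesis
    proof (cases "x \<le> 0")
      case True
      then have "x \<le> exp r" "\<not> exp r \<le> x" using * by linarith+
      then show ?thesis using real True by (simp add: ln_star_def)
    next
      case False
      then have "ln x \<le> r \<longleftrightarrow> x \<le> exp r" "r \<le> ln x \<longleftrightarrow> exp r \<le> x"
        using ln_le_cancel_iff[of x "exp r"] ln_le_cancel_iff[of "exp r" x] by simp_all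
      then show ?thesis using real False by (simp add: ln_star_def)
    qed
  qed (auto simp: ln_star_def)
  then show "ln_star p \<le> ereal r \<longleftrightarrow> p \<le> ereal (exp r)" "ereal r \<le> ln_star p \<longleftrightarrow> ereal (exp r) \<le> p"
    by auto
qed

lemma ereal_ratio_le_iff:
  assumes "0 \<le> s" "0 < k" "0 < E"
  shows "ereal c / ereal s * ereal k \<le> ereal E \<longleftrightarrow> c * k \<le> E * s"
proof (cases "s = 0")
  case True
  consider "c < 0" | "c = 0" | "c > 0" by linarith
  then show ?thesis
  proof cases
    case 1
    have "c * k < 0" using 1 assms by (simp add: mult_neg_pos)
    then show ?thesis using True 1 assms by (simp add: divide_ereal_def)
  next
    case 2
    then show ?thesis using True assms by (simp add: divide_ereal_def)
  next
    case 3
    have "c * k > 0" using 3 assms by simp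
    then have "\<not> c * k \<le> 0" by simp
    then show ?thesis using True 3 assms by (simp add: divide_ereal_def del: mult_le_0_iff)
  qed
qed (use assms in \<open>simp add: field_simps\<close>)

lemma le_ereal_ratio_iff:
  assumes "0 \<le> s" "0 < k" "0 < c"
  shows "ereal E \<le> ereal c / ereal s * ereal k \<longleftrightarrow> E * s \<le> c * k"
proof (cases "s = 0")
  case True
  have "c * k > 0" using assms by simp
  then show ?thesis using True assms by (simp add: divide_ereal_def)
qed (use assms in \<open>simp add: field_simps\<close>)

text \<open>Every extension in the definition of the bounds is monotone, and $\gamma$ lies strictly between the values
substituted at the boundary, so the inequality can be solved for \<open>s\<close>. The result is linear in \<open>s\<close> and includes
$s = 0$; in particular it describes a measurable event.\<close>

lemma gamma_inf_le_iff:
  assumes T: "0 < T" "T < real n" and \<gamma>: "0 < \<gamma>" "\<gamma> < 1" and "0 < \<kappa>" "0 \<le> s"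
  shows "gamma_inf n T \<kappa> e u \<alpha> s \<le> \<gamma> \<longleftrightarrow> (x_l n u e (\<alpha> / 2) - e) * \<kappa>\<^sup>2 \<le> exp (g_fun n T \<gamma>) * s"
proof -
  have g: "- ln 3 < g_fun n T \<gamma>"
    using g_fun_strict_mono[OF T, of 0 \<gamma>] \<gamma> by (simp add: g_fun_0)
  define q where "q = ereal (x_l n u e (\<alpha> / 2) - e) / ereal s * ereal (\<kappa>\<^sup>2)"
  have "gamma_inf n T \<kappa> e u \<alpha> s \<le> \<gamma> \<longleftrightarrow> ln_star (max q 0) \<le> ereal (g_fun n T \<gamma>)"
    unfolding gamma_inf_def q_def[symmetric] max.bounded_iff g_inv_le_iff[OF T \<gamma>] 
    using \<gamma> g by simp
  also have "\<dots> \<longleftrightarrow> q \<le> ereal (exp (g_fun n T \<gamma>))"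
    by (simp add: ln_star_le_iff)
  finally show ?thesis
    using assms unfolding q_def by (subst (asm) ereal_ratio_le_iff) auto
qed

lemma le_gamma_sup_iff:
  assumes T: "0 < T" "T < real n" and \<gamma>: "0 < \<gamma>" "\<gamma> < 1" and "0 < \<kappa>" "0 \<le> s"
    and "0 < x_r n u e (\<alpha> / 2) + e"
  shows "\<gamma> \<le> gamma_sup n T \<kappa> e u \<alpha> s \<longleftrightarrow> exp (g_fun n T \<gamma>) * s \<le> (x_r n u e (\<alpha> / 2) + e) * \<kappa>\<^sup>2"
proof -
  have "\<gamma> \<le> gamma_sup n T \<kappa> e u \<alpha> s \<longleftrightarrow>
      ereal (exp (g_fun n T \<gamma>)) \<le> ereal (x_r n u e (\<alpha> / 2) + e) / ereal s * ereal (\<kappa>\<^sup>2)"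
    using \<gamma> by (simp add: gamma_sup_def le_g_inv_iff[OF T \<gamma>] le_ln_star_iff)
  then show ?thesis
    using assms by (subst (asm) le_ereal_ratio_iff) auto
qed

section \<open>Second differences of a Gaussian process\<close>

lemma gaussian_rv_integrable:
  assumes "prob_space M" "gaussian_rv M Z"
  shows "integrable M Z"
proof -
  interpret prob_space M by fact
  have Z[measurable]: "Z \<in> borel_measurable M" using assms by (simp add: gaussian_rv_def)
  obtain \<mu> where "(\<exists>\<sigma>>0. distributed M lborel Z (normal_density \<mu> \<sigma>)) \<or> (AE \<omega> in M. Z \<omega> = \<mu>)"
    using assms by (auto simp: gaussian_rv_def)
  then show ?thesis
  proof
    assume "\<exists>\<sigma>>0. distributed M lborel Z (normal_density \<mu> \<sigma>)"
    then obtain \<sigma> where \<sigma>: "\<sigma> > 0" and Z': "distributed M lborel Z (normal_density \<mu> \<sigma>)" by auto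
    show ?thesis
      using distributed_integrable[OF Z', of "\<lambda>x. x"] integrable_normal_moment_nz_1[OF \<sigma>, of \<mu>]
      by (simp add: normal_density_nonneg)
  next
    assume "AE \<omega> in M. Z \<omega> = \<mu>"
    then show ?thesis by (subst integrable_cong_AE[of _ _ "\<lambda>_. \<mu>"]) auto
  qed
qed

text \<open>The points \<open>p k\<close> may coincide, whereas Gaussian processes are defined through sums over sets of times; equal
points are collected first.\<close>

lemma gaussian_process_combination:
  assumes M: "prob_space M" and X: "gaussian_process M T X" "centered_process M T X"
    and K: "finite K" "p ` K \<subseteq> {0..T}"
  shows "gaussian_rv M (\<lambda>\<omega>. \<Sum>k\<in>K. c k * X (p k) \<omega>)" "(\<integral>\<omega>. (\<Sum>k\<in>K. c k * X (p k) \<omega>) \<partial>M) = 0"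
proof -
  have gX: "gaussian_rv M (X t)" if "t \<in> {0..T}" for t
    using X(1)[unfolded gaussian_process_def, rule_format, of "{t}" "\<lambda>_. 1"] that by simp
  have int: "integrable M (X (p k))" if "k \<in> K" for k
    using gaussian_rv_integrable[OF M gX] K that by blast
  have "(\<Sum>k\<in>K. c k * X (p k) \<omega>) = (\<Sum>t\<in>p ` K. (\<Sum>k\<in>{k \<in> K. p k = t}. c k) * X t \<omega>)" for \<omega>
    by (subst sum.image_gen[OF K(1), of _ p]) (simp add: sum_distrib_right)
  then show "gaussian_rv M (\<lambda>\<omega>. \<Sum>k\<in>K. c k * X (p k) \<omega>)"
    using X(1) K by (simp add: gaussian_process_def)
  have "(\<integral>\<omega>. (\<Sum>k\<in>K. c k * X (p k) \<omega>) \<partial>M) = (\<Sum>k\<in>K. c k * (\<integral>\<omega>. X (p k) \<omega> \<partial>M))"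
    using int by simp
  also have "\<dots> = 0"
    using X(2) K by (intro sum.neutral) (auto simp: centered_process_def)
  finally show "(\<integral>\<omega>. (\<Sum>k\<in>K. c k * X (p k) \<omega>) \<partial>M) = 0" .
qed

lemma normalized_diff_gaussian_family:
  assumes M: "prob_space M" and X: "gaussian_process M T X" "centered_process M T X" and "0 < T"
  shows "centered_gaussian_family M {1..n - 1} (normalized_diff T X \<gamma> \<kappa> n)"
proof -
  define a where "a = real n powr \<gamma> / (T powr \<gamma> * \<kappa> * sqrt (4 - 2 powr (2 * \<gamma>)))"
  \<comment> \<open>The pair \<open>(k, j)\<close> stands for the \<open>j\<close>-th of the three grid points in the \<open>k\<close>-th second difference.\<close>
  define K where "K = {1..n - 1} \<times> {0, 1, 2::nat}"
  define p where "p = (\<lambda>(k, j). grid T n (k - 1 + j))"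
  have a: "normalized_diff T X \<gamma> \<kappa> n k \<omega> = a * second_diff T X n k \<omega>" for k \<omega>
    by (simp add: normalized_diff_def a_def)
  have "grid T n m \<in> {0..T}" if "m \<le> n" for m
  proof -
    have "real m * T \<le> real n * T" using that \<open>0 < T\<close> by simp
    then show ?thesis using \<open>0 < T\<close> by (auto simp: grid_def divide_le_eq mult.commute)
  qed
  then have K: "finite K" "p ` K \<subseteq> {0..T}" by (auto simp: K_def p_def)
  show ?thesis
    unfolding centered_gaussian_family_def
  proof (intro allI)
    fix c :: "nat \<Rightarrow> real"
    define w where "w = (\<lambda>(k, j). c k * a * (if j = (1::nat) then - 2 else 1))"
    have "(\<Sum>k = 1..n - 1. c k * normalized_diff T X \<gamma> \<kappa> n k \<omega>) = (\<Sum>x\<in>K. w x * X (p x) \<omega>)" for \<omega>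
    proof -
      have "(\<Sum>x\<in>K. w x * X (p x) \<omega>) = (\<Sum>k\<in>{1..n - 1}. \<Sum>j\<in>{0, 1, 2}. w (k, j) * X (p (k, j)) \<omega>)"
        unfolding K_def by (subst sum.cartesian_product) (simp add: case_prod_unfold)
      also have "\<dots> = (\<Sum>k\<in>{1..n - 1}. c k * normalized_diff T X \<gamma> \<kappa> n k \<omega>)"
        by (intro sum.cong refl)
           (simp add: w_def p_def a second_diff_def algebra_simps)
      finally show ?thesis ..
    qed
    then show "gaussian_rv M (\<lambda>\<omega>. \<Sum>k\<in>{1..n - 1}. c k * normalized_diff T X \<gamma> \<kappa> n k \<omega>) \<and>
        (\<integral>\<omega>. (\<Sum>k\<in>{1..n - 1}. c k * normalized_diff T X \<gamma> \<kappa> n k \<omega>) \<partial>M) = 0"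
      using gaussian_process_combination[OF M X K, of w] by simp
  qed
qed

text \<open>The squared normalizing factor is $e^{g(\gamma)}/\kappa^2$, because
$e^{g(\gamma)} = (n/T)^{2\gamma}/(4 - 2^{2\gamma})$.\<close>

lemma sum_normalized_diff_squares:
  assumes "0 < T" "T < real n" "0 < \<gamma>" "\<gamma> < 1" "0 < \<kappa>" "2 \<le> n"
  shows "(\<Sum>k = 1..n - 1. (normalized_diff T X \<gamma> \<kappa> n k \<omega>)\<^sup>2) =
    (real n - 1) * (exp (g_fun n T \<gamma>) * mean_square_diff T X n \<omega> / \<kappa>\<^sup>2)"
proof -
  have pos: "4 - 2 powr (2 * \<gamma>) > 0" using assms by (intro four_minus_powr_pos)
  have sq: "(y powr \<gamma>)\<^sup>2 = y powr (2 * \<gamma>)" for y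
    by (simp only: power2_eq_square mult_2 powr_add)
  have "exp (g_fun n T \<gamma>) = real n powr (2 * \<gamma>) / T powr (2 * \<gamma>) / (4 - 2 powr (2 * \<gamma>))"
  proof -
    have "exp (g_fun n T \<gamma>) = exp (2 * \<gamma> * ln (real n / T)) / exp (ln (4 - 2 powr (2 * \<gamma>)))"
      unfolding g_fun_def by (rule exp_diff)
    also have "exp (2 * \<gamma> * ln (real n / T)) = (real n / T) powr (2 * \<gamma>)"
      using assms by (simp only: powr_def) simp
    finally show ?thesis using assms pos by (simp add: powr_divide)
  qed
  then have coeff: "(real n powr \<gamma> / (T powr \<gamma> * \<kappa> * sqrt (4 - 2 powr (2 * \<gamma>))))\<^sup>2 = exp (g_fun n T \<gamma>) / \<kappa>\<^sup>2"
    using pos by (simp add: power_divide power_mult_distrib sq)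
  show ?thesis
    using assms(6)
    by (simp only: normalized_diff_def power_mult_distrib coeff sum_distrib_left[symmetric] mean_square_diff_def)
       simp
qed

section \<open>The confidence interval\<close>

theorem theorem6:
  fixes M :: "'a measure" and X :: "real \<Rightarrow> 'a \<Rightarrow> real"
    and T \<gamma> \<kappa> \<alpha> :: real and \<epsilon> \<upsilon> :: "nat \<Rightarrow> real" and n :: nat
  assumes "prob_space M"
    and "T > 0"
    and "gaussian_process M T X"
    and "centered_process M T X"
    and "0 < \<gamma>" "\<gamma> < 1" "\<kappa> > 0"
    and "cond_C1 M X \<gamma>"
    and "cond_C2 M T X \<gamma> \<kappa>"
    and "\<And>m. m \<ge> 2 \<Longrightarrow>
      \<bar>1 / (real m - 1) * (\<Sum>k = 1..m - 1. diff_cov M T X \<gamma> \<kappa> m k k) - 1\<bar> \<le> \<epsilon> m"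
    and "antimono_on {2..} \<epsilon>" "\<epsilon> \<longlonglongrightarrow> 0"
    and "\<And>m. m \<ge> 2 \<Longrightarrow> \<upsilon> m > 0"
    and "\<And>m. m \<ge> 2 \<Longrightarrow> max_row_sum M T X \<gamma> \<kappa> m \<le> \<upsilon> m"
    and "0 < \<alpha>" "\<alpha> < 1"
    and "n \<ge> 2" "real n > T"
  shows "\<P>(\<omega> in M. \<gamma> \<in> {gamma_inf n T \<kappa> (\<epsilon> n) (\<upsilon> n) \<alpha> (mean_square_diff T X n \<omega>) ..
                       gamma_sup n T \<kappa> (\<epsilon> n) (\<upsilon> n) \<alpha> (mean_square_diff T X n \<omega>)}) \<ge> 1 - \<alpha>"
proof -
  note M = assms(1) and T = assms(2) and n = assms(17,18) and mean = assms(10)[OF assms(17)]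
    and \<upsilon> = assms(13)[OF assms(17)] and rows = assms(14)[OF assms(17)] and \<gamma> = assms(5,6) and \<kappa> = assms(7)
  interpret prob_space M by fact
  define N where "N = real n - 1"
  have N: "0 < N" using n by (simp add: N_def)
  have NN: "sqrt N * sqrt N = N" using N by simp
  define Y where "Y = normalized_diff T X \<gamma> \<kappa> n"
  define I where "I = {1..n - 1}"
  define Q where "Q = (\<lambda>\<omega>. \<Sum>k\<in>I. (Y k \<omega>)\<^sup>2)"
  define \<tau> where "\<tau> = (\<Sum>i\<in>I. \<integral>\<omega>. Y i \<omega> * Y i \<omega> \<partial>M)"
  define e where "e = \<epsilon> n"
  define u where "u = \<upsilon> n"
  \<comment> \<open>The bound on the trace that turns the tail bounds into \<open>phi_r\<close> and \<open>phi_l\<close>.\<close>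
  define A where "A = N * (1 + e)"
  define ql where "ql = q_l n u e (\<alpha> / 2)"
  define qr where "qr = q_r n u e (\<alpha> / 2)"
  have fin: "finite I" by (simp add: I_def)
  have Y: "centered_gaussian_family M I Y"
    unfolding I_def Y_def by (rule normalized_diff_gaussian_family[OF M assms(3,4) T])
  have cov: "diff_cov M T X \<gamma> \<kappa> n i j = (\<integral>\<omega>. Y i \<omega> * Y j \<omega> \<partial>M)" for i j
    by (simp add: diff_cov_def Y_def)
  have row: "(\<Sum>j\<in>I. \<bar>\<integral>\<omega>. Y i \<omega> * Y j \<omega> \<partial>M\<bar>) \<le> u" if "i \<in> I" for i
  proof -
    have "(\<Sum>j\<in>I. \<bar>\<integral>\<omega>. Y i \<omega> * Y j \<omega> \<partial>M\<bar>) \<le> max_row_sum M T X \<gamma> \<kappa> n"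
      unfolding max_row_sum_def cov I_def[symmetric] using that fin by (intro Max_ge) auto
    then show ?thesis using rows by (simp add: u_def)
  qed
  have mean': "\<bar>\<tau> / N - 1\<bar> \<le> e"
    using mean by (simp add: cov \<tau>_def I_def N_def e_def)
  then have e: "0 \<le> e" by linarith
  have "\<tau> / N \<le> 1 + e" "1 - e \<le> \<tau> / N" using mean' by linarith+
  then have \<tau>: "\<tau> \<le> A" "N * (1 - e) \<le> \<tau>"
    using N by (simp_all add: A_def field_simps)
  have A: "0 < A" using N e by (simp add: A_def)
  have u: "0 < u" using \<upsilon> by (simp add: u_def)
  have \<alpha>: "0 < \<alpha> / 2" "\<alpha> / 2 < 1" using assms(15,16) by simp_all
  have qr: "0 < qr" "phi_r n u e qr = \<alpha> / 2"
    unfolding qr_def by (rule q_r_solves[OF n(1) u e \<alpha>])+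
  have ql: "0 < ql" "ql < (e + 1) * sqrt N" "phi_l n u e ql = \<alpha> / 2"
    unfolding ql_def N_def by (rule q_l_solves[OF n(1) u e \<alpha>])+
  have ratio: "z * sqrt N / A = z / ((e + 1) * sqrt N)" for z
  proof -
    have "A = ((e + 1) * sqrt N) * sqrt N" unfolding A_def mult.assoc NN by simp
    then show ?thesis using N by simp
  qed
  have A': "(e + 1) * N = A" by (simp add: A_def mult.commute add.commute)
  have "prob {\<omega> \<in> space M. \<tau> + qr * sqrt N \<le> Q \<omega>} \<le>
      exp (- (qr * sqrt N) / (2 * u)) * (1 + qr * sqrt N / A) powr (A / (2 * u))"
    unfolding Q_def using N qr(1)
    by (intro gaussian_quadratic_upper_tail[OF M Y fin row u \<tau>_def \<tau>(1) A]) auto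
  also have "\<dots> = \<alpha> / 2"
    using qr(2) by (simp only: phi_r_def N_def[symmetric] A' ratio)
  finally have upper: "prob {\<omega> \<in> space M. \<tau> + qr * sqrt N \<le> Q \<omega>} \<le> \<alpha> / 2" .
  have "ql * sqrt N < ((e + 1) * sqrt N) * sqrt N" using ql N by (intro mult_strict_right_mono) auto
  then have qlA: "ql * sqrt N < A" unfolding A_def mult.assoc NN by (simp add: mult.commute add.commute)
  have ind: "indicator {0..(e + 1) * sqrt N} ql = (1::real)" using ql by simp
  have "prob {\<omega> \<in> space M. Q \<omega> \<le> \<tau> - ql * sqrt N} \<le>
      exp (ql * sqrt N / (2 * u)) * (1 - ql * sqrt N / A) powr (A / (2 * u))"
    unfolding Q_def using N ql(1) qlA
    by (intro gaussian_quadratic_lower_tail[OF M Y fin row u \<tau>_def \<tau>(1)]) auto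
  also have "\<dots> = \<alpha> / 2"
    using ql(3) ind by (simp only: phi_l_def N_def[symmetric] A' ratio mult_1_right)
  finally have lower: "prob {\<omega> \<in> space M. Q \<omega> \<le> \<tau> - ql * sqrt N} \<le> \<alpha> / 2" .
  have [measurable]: "Y i \<in> borel_measurable M" if "i \<in> I" for i
    using centered_gaussian_familyD(1)[OF Y fin that] by (simp add: gaussian_rv_def)
  have [measurable]: "Q \<in> borel_measurable M" unfolding Q_def by measurable
  have S: "exp (g_fun n T \<gamma>) * mean_square_diff T X n \<omega> = Q \<omega> / N * \<kappa>\<^sup>2" for \<omega>
    using sum_normalized_diff_squares[OF T n(2) \<gamma> \<kappa> n(1), of X \<omega>] N \<kappa>
    by (simp add: Q_def I_def Y_def N_def)
  have S0: "0 \<le> mean_square_diff T X n \<omega>" for \<omega>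
    using N by (simp add: mean_square_diff_def N_def sum_nonneg)
  have xr: "x_r n u e (\<alpha> / 2) + e = 1 + e + qr / sqrt N" and xl: "x_l n u e (\<alpha> / 2) - e = 1 - e - ql / sqrt N"
    by (simp_all add: x_r_def x_l_def qr_def ql_def N_def)
  have xr0: "0 < x_r n u e (\<alpha> / 2) + e"
  proof -
    have "0 < qr / sqrt N" using qr(1) N by simp
    then show ?thesis using e unfolding xr by linarith
  qed
  have inf: "gamma_inf n T \<kappa> e u \<alpha> (mean_square_diff T X n \<omega>) \<le> \<gamma> \<longleftrightarrow> 1 - e - ql / sqrt N \<le> Q \<omega> / N" for \<omega>
    using \<kappa> by (subst gamma_inf_le_iff[OF T n(2) \<gamma> \<kappa> S0]) (simp only: S xl mult_le_cancel_right_pos zero_less_power)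
  have sup: "\<gamma> \<le> gamma_sup n T \<kappa> e u \<alpha> (mean_square_diff T X n \<omega>) \<longleftrightarrow> Q \<omega> / N \<le> 1 + e + qr / sqrt N" for \<omega>
    using \<kappa> by (subst le_gamma_sup_iff[OF T n(2) \<gamma> \<kappa> S0 xr0]) (simp only: S xr mult_le_cancel_right_pos zero_less_power)
  let ?G = "{\<omega> \<in> space M. 1 - e - ql / sqrt N \<le> Q \<omega> / N \<and> Q \<omega> / N \<le> 1 + e + qr / sqrt N}"
  have Nq: "N * (z / sqrt N) = z * sqrt N" for z
    using N NN by (simp add: field_simps)
  \<comment> \<open>Outside the event, \<open>Q\<close> deviates from its mean \<open>\<tau>\<close>, which lies between $N(1-e)$ and $N(1+e)$.\<close>
  have "space M - ?G \<subseteq> {\<omega> \<in> space M. \<tau> + qr * sqrt N \<le> Q \<omega>} \<union> {\<omega> \<in> space M. Q \<omega> \<le> \<tau> - ql * sqrt N}"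
  proof
    fix \<omega> assume \<omega>: "\<omega> \<in> space M - ?G"
    have QN: "Q \<omega> = N * (Q \<omega> / N)" using N by simp
    from \<omega> consider "Q \<omega> / N < 1 - e - ql / sqrt N" | "1 + e + qr / sqrt N < Q \<omega> / N" by force
    then show "\<omega> \<in> {\<omega> \<in> space M. \<tau> + qr * sqrt N \<le> Q \<omega>} \<union> {\<omega> \<in> space M. Q \<omega> \<le> \<tau> - ql * sqrt N}"
    proof cases
      case 1
      then have "N * (Q \<omega> / N) \<le> N * ((1 - e) - ql / sqrt N)" using N by (intro mult_left_mono) auto
      then have "Q \<omega> \<le> \<tau> - ql * sqrt N" using \<tau>(2) unfolding right_diff_distrib[of N "1 - e"] Nq QN[symmetric] by linarith
      then show ?thesis using \<omega> by simp
    next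
      case 2
      then have "N * ((1 + e) + qr / sqrt N) \<le> N * (Q \<omega> / N)" using N by (intro mult_left_mono) auto
      then have "\<tau> + qr * sqrt N \<le> Q \<omega>"
        using \<tau>(1) unfolding distrib_left[of N "1 + e"] Nq QN[symmetric] A_def by linarith
      then show ?thesis using \<omega> by simp
    qed
  qed
  then have "prob (space M - ?G) \<le>
      prob ({\<omega> \<in> space M. \<tau> + qr * sqrt N \<le> Q \<omega>} \<union> {\<omega> \<in> space M. Q \<omega> \<le> \<tau> - ql * sqrt N})"
    by (intro finite_measure_mono) measurable
  also have "\<dots> \<le> prob {\<omega> \<in> space M. \<tau> + qr * sqrt N \<le> Q \<omega>} + prob {\<omega> \<in> space M. Q \<omega> \<le> \<tau> - ql * sqrt N}"
    by (intro measure_Un_le) measurable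
  also have "\<dots> \<le> \<alpha>" using upper lower by simp
  finally have "1 - \<alpha> \<le> prob ?G"
    by (subst (asm) prob_compl) simp_all
  then show ?thesis
    by (simp only: atLeastAtMost_iff inf[unfolded e_def u_def] sup[unfolded e_def u_def]) (simp only: e_def)
qed

end
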